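(* Let $X, Y, Z$ be Banach spaces with $X\subseteq Z$ (as a closed subspace), let $\lambda\ge 1$, suppose that $X^{**}$ is a $P_\lambda$-space, and let $1<p<\infty$. If $T\in K_p^d(X,Y)$, then there exists an extension $\widetilde T\in K_p^d(Z,Y)$ of $T$ with $\kappa_p^d(\widetilde T)\le\lambda\,\kappa_p^d(T)$.
   Context: Banach spaces are over the complex scalars; $B(X,Y)$ is the space of bounded linear operators and $B_X$ the closed unit ball. A Banach space $E$ is a $P_\lambda$-space if for every Banach space $F\supseteq E$ there is a projection $P:F\to E$ with $\|P\|\le\lambda$. For $1<p<\infty$ let $\frac1p+\frac1q=1$. $\ell_p^s(Y)$ is the space of sequences $(y_n)$ in $Y$ with $\|(y_n)\|_p^s=(\sum_n\|y_n\|^p)^{1/p}<\infty$, and $E_y:\ell_q\to Y$ is $E_y((\alpha_n))=\sum_n\alpha_n y_n$. An operator $S\in B(X,Y)$ is $p$-compact, $S\in K_p(X,Y)$, if there is $y\in\ell_p^s(Y)$ with $S(B_X)\subseteq E_y(B_{\ell_q})$, and $\kappa_p(S)$ is the infimum of $\|y\|_p^s$ over all such $y$. $K_p^d(X,Y)=\{T\in B(X,Y): T^*\in K_p(Y^*,X^* )\}$ with $\kappa_p^d(T)=\kappa_p(T^* )$. *)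

theory Defs
  imports "HOL-Analysis.Analysis"
begin

section \<open>Complex normed spaces and Banach spaces\<close>

class complex_normed_vector = real_normed_vector +
  fixes scaleC :: "complex \<Rightarrow> 'a \<Rightarrow> 'a" (infixr "*\<^sub>C" 75)
  assumes scaleC_add_right: "a *\<^sub>C (x + y) = a *\<^sub>C x + a *\<^sub>C y"
    and scaleC_add_left: "(a + b) *\<^sub>C x = a *\<^sub>C x + b *\<^sub>C x"
    and scaleC_scaleC: "a *\<^sub>C b *\<^sub>C x = (a * b) *\<^sub>C x"
    and scaleR_scaleC: "r *\<^sub>R x = complex_of_real r *\<^sub>C x"
    and norm_scaleC: "norm (a *\<^sub>C x) = cmod a * norm x"

class complex_banach = complex_normed_vector + banach

instantiation complex :: complex_banach
begin

definition scaleC_complex :: "complex \<Rightarrow> complex \<Rightarrow> complex"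
  where "scaleC_complex a x = a * x"

instance
  by standard (auto simp: scaleC_complex_def algebra_simps norm_mult scaleR_conv_of_real)

end

lemma scaleC_one: "1 *\<^sub>C x = (x :: 'a::complex_normed_vector)"
  using scaleR_scaleC[of 1 x] by simp

lemma scaleC_zero_right: "a *\<^sub>C 0 = (0 :: 'a::complex_normed_vector)"
  using norm_scaleC[of a "0::'a"] by simp

lemma scaleC_minus_right: "a *\<^sub>C (- x) = - (a *\<^sub>C (x :: 'a::complex_normed_vector))"
  using scaleC_add_right[of a x "- x"] by (simp add: scaleC_zero_right add_eq_0_iff)

lemma scaleC_diff_right: "a *\<^sub>C (x - y) = a *\<^sub>C x - a *\<^sub>C (y :: 'a::complex_normed_vector)"
  using scaleC_add_right[of a x "- y"] by (simp add: scaleC_minus_right)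

lemma bounded_linear_scaleC: "bounded_linear (\<lambda>x::'a::complex_normed_vector. a *\<^sub>C x)"
proof (rule bounded_linear_intro[where K = "cmod a"])
  fix r and x :: 'a
  show "a *\<^sub>C (r *\<^sub>R x) = r *\<^sub>R (a *\<^sub>C x)"
    by (simp add: scaleR_scaleC scaleC_scaleC mult.commute)
qed (simp_all add: scaleC_add_right norm_scaleC mult.commute)


section \<open>The Banach space of bounded operators\<close>

definition bounded_clinear ::
    "('a::complex_normed_vector \<Rightarrow> 'b::complex_normed_vector) \<Rightarrow> bool"
  where "bounded_clinear f \<longleftrightarrow> bounded_linear f \<and> (\<forall>c x. f (c *\<^sub>C x) = c *\<^sub>C f x)"

typedef (overloaded) ('a, 'b) cblinfun ("(_ \<Rightarrow>\<^sub>C\<^sub>L /_)" [22, 21] 21) =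
  "{f :: 'a::complex_normed_vector \<Rightarrow> 'b::complex_normed_vector. bounded_clinear f}"
  morphisms cblinfun_apply CBlinfun
proof
  show "(\<lambda>x. 0) \<in> {f :: 'a \<Rightarrow> 'b. bounded_clinear f}"
    by (simp add: bounded_clinear_def scaleC_zero_right)
qed

setup_lifting type_definition_cblinfun

declare [[coercion cblinfun_apply]]

lemma cblinfun_eqI: "(\<And>x. cblinfun_apply f x = cblinfun_apply g x) \<Longrightarrow> f = g"
  by transfer auto

instantiation cblinfun :: (complex_normed_vector, complex_normed_vector) complex_normed_vector
begin

lift_definition zero_cblinfun :: "'a \<Rightarrow>\<^sub>C\<^sub>L 'b" is "\<lambda>x. 0"
  by (simp add: bounded_clinear_def scaleC_zero_right)

lift_definition plus_cblinfun :: "('a \<Rightarrow>\<^sub>C\<^sub>L 'b) \<Rightarrow> ('a \<Rightarrow>\<^sub>C\<^sub>L 'b) \<Rightarrow> 'a \<Rightarrow>\<^sub>C\<^sub>L 'b"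
  is "\<lambda>f g x. f x + g x"
  by (simp add: bounded_clinear_def bounded_linear_add scaleC_add_right)

lift_definition uminus_cblinfun :: "('a \<Rightarrow>\<^sub>C\<^sub>L 'b) \<Rightarrow> 'a \<Rightarrow>\<^sub>C\<^sub>L 'b"
  is "\<lambda>f x. - f x"
  by (simp add: bounded_clinear_def bounded_linear_minus scaleC_minus_right)

lift_definition minus_cblinfun :: "('a \<Rightarrow>\<^sub>C\<^sub>L 'b) \<Rightarrow> ('a \<Rightarrow>\<^sub>C\<^sub>L 'b) \<Rightarrow> 'a \<Rightarrow>\<^sub>C\<^sub>L 'b"
  is "\<lambda>f g x. f x - g x"
  by (simp add: bounded_clinear_def bounded_linear_sub scaleC_diff_right)

lift_definition scaleC_cblinfun :: "complex \<Rightarrow> ('a \<Rightarrow>\<^sub>C\<^sub>L 'b) \<Rightarrow> 'a \<Rightarrow>\<^sub>C\<^sub>L 'b"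
  is "\<lambda>c f x. c *\<^sub>C f x"
  by (auto simp: bounded_clinear_def scaleC_scaleC mult.commute
      intro: bounded_linear_compose[OF bounded_linear_scaleC])

lift_definition scaleR_cblinfun :: "real \<Rightarrow> ('a \<Rightarrow>\<^sub>C\<^sub>L 'b) \<Rightarrow> 'a \<Rightarrow>\<^sub>C\<^sub>L 'b"
  is "\<lambda>r f x. r *\<^sub>R f x"
  by (auto simp: bounded_clinear_def scaleR_scaleC scaleC_scaleC mult.commute
      intro: bounded_linear_compose[OF bounded_linear_scaleC])

lift_definition norm_cblinfun :: "('a \<Rightarrow>\<^sub>C\<^sub>L 'b) \<Rightarrow> real" is onorm .

definition dist_cblinfun :: "('a \<Rightarrow>\<^sub>C\<^sub>L 'b) \<Rightarrow> ('a \<Rightarrow>\<^sub>C\<^sub>L 'b) \<Rightarrow> real"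
  where "dist_cblinfun f g = norm (f - g)"

definition sgn_cblinfun :: "('a \<Rightarrow>\<^sub>C\<^sub>L 'b) \<Rightarrow> 'a \<Rightarrow>\<^sub>C\<^sub>L 'b"
  where "sgn_cblinfun f = inverse (norm f) *\<^sub>R f"

definition "(uniformity :: (('a \<Rightarrow>\<^sub>C\<^sub>L 'b) \<times> ('a \<Rightarrow>\<^sub>C\<^sub>L 'b)) filter) =
     (INF e\<in>{0 <..}. principal {(x, y). dist x y < e})"

definition open_cblinfun :: "('a \<Rightarrow>\<^sub>C\<^sub>L 'b) set \<Rightarrow> bool"
  where "open_cblinfun S = (\<forall>x\<in>S. \<forall>\<^sub>F (x', y) in uniformity. x' = x \<longrightarrow> y \<in> S)"

instance
proof
  fix f g h :: "'a \<Rightarrow>\<^sub>C\<^sub>L 'b" and r s :: real and a b :: complex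
  show "f + g + h = f + (g + h)" by transfer (simp add: add.assoc)
  show "f + g = g + f" by transfer (simp add: add.commute)
  show "0 + f = f" by transfer simp
  show "- f + f = 0" by transfer simp
  show "f - g = f + - g" by transfer simp
  show "r *\<^sub>R (f + g) = r *\<^sub>R f + r *\<^sub>R g" by transfer (simp add: scaleR_add_right)
  show "(r + s) *\<^sub>R f = r *\<^sub>R f + s *\<^sub>R f" by transfer (simp add: scaleR_add_left)
  show "r *\<^sub>R s *\<^sub>R f = (r * s) *\<^sub>R f" by transfer simp
  show "1 *\<^sub>R f = f" by transfer simp
  show "dist f g = norm (f - g)" by (rule dist_cblinfun_def)
  show "sgn f = inverse (norm f) *\<^sub>R f" by (rule sgn_cblinfun_def)
  show "(uniformity :: (('a \<Rightarrow>\<^sub>C\<^sub>L 'b) \<times> ('a \<Rightarrow>\<^sub>C\<^sub>L 'b)) filter) =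
     (INF e\<in>{0 <..}. principal {(x, y). dist x y < e})"
    by (rule uniformity_cblinfun_def)
  show "open S = (\<forall>x\<in>S. \<forall>\<^sub>F (x', y) in uniformity. x' = x \<longrightarrow> y \<in> S)"
    for S :: "('a \<Rightarrow>\<^sub>C\<^sub>L 'b) set"
    by (rule open_cblinfun_def)
  show "norm f = 0 \<longleftrightarrow> f = 0"
    by transfer (auto simp: bounded_clinear_def onorm_eq_0 fun_eq_iff)
  show "norm (f + g) \<le> norm f + norm g"
    by transfer (auto simp: bounded_clinear_def intro: onorm_triangle)
  show "norm (r *\<^sub>R f) = \<bar>r\<bar> * norm f"
    by transfer (auto simp: bounded_clinear_def onorm_scaleR)
  show "a *\<^sub>C (f + g) = a *\<^sub>C f + a *\<^sub>C g" by transfer (simp add: scaleC_add_right)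
  show "(a + b) *\<^sub>C f = a *\<^sub>C f + b *\<^sub>C f" by transfer (simp add: scaleC_add_left)
  show "a *\<^sub>C b *\<^sub>C f = (a * b) *\<^sub>C f" by transfer (simp add: scaleC_scaleC)
  show "r *\<^sub>R f = complex_of_real r *\<^sub>C f" by transfer (simp add: scaleR_scaleC)
  show "norm (a *\<^sub>C f) = cmod a * norm f"
  proof transfer
    fix a :: complex and f :: "'a \<Rightarrow> 'b"
    assume f: "bounded_clinear f"
    have le: "onorm (\<lambda>x. c *\<^sub>C h x) \<le> cmod c * onorm h"
      if "bounded_clinear h" for c and h :: "'a \<Rightarrow> 'b"
    proof (rule onorm_bound)
      have h: "bounded_linear h" using that by (simp add: bounded_clinear_def)
      show "0 \<le> cmod c * onorm h" by (simp add: onorm_pos_le[OF h])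
      show "norm (c *\<^sub>C h x) \<le> cmod c * onorm h * norm x" for x
        using mult_left_mono[OF onorm[OF h, of x], of "cmod c"]
        by (simp add: norm_scaleC mult.assoc)
    qed
    show "onorm (\<lambda>x. a *\<^sub>C f x) = cmod a * onorm f"
    proof (cases "a = 0")
      case True
      then have "(\<lambda>x. a *\<^sub>C f x) = (\<lambda>x. 0)"
        using norm_scaleC[of a] by (metis mult_zero_left norm_eq_zero)
      then show ?thesis using True by (simp add: onorm_zero)
    next
      case False
      have af: "bounded_clinear (\<lambda>x. a *\<^sub>C f x)"
        using f by (auto simp: bounded_clinear_def scaleC_scaleC mult.commute
          intro: bounded_linear_compose[OF bounded_linear_scaleC])
      have "onorm f \<le> cmod (inverse a) * onorm (\<lambda>x. a *\<^sub>C f x)"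
        using le[OF af, of "inverse a"] False by (simp add: scaleC_scaleC scaleC_one)
      then have "cmod a * onorm f \<le> onorm (\<lambda>x. a *\<^sub>C f x)"
        using False by (simp add: norm_inverse norm_divide field_simps)
      with le[OF f, of a] show ?thesis by simp
    qed
  qed
qed

end

lift_definition blinfun_of_cblinfun ::
    "('a::complex_normed_vector \<Rightarrow>\<^sub>C\<^sub>L 'b::complex_normed_vector) \<Rightarrow> ('a \<Rightarrow>\<^sub>L 'b)"
  is "\<lambda>f. f"
  by (simp add: bounded_clinear_def)

lemma dist_blinfun_of_cblinfun: "dist (blinfun_of_cblinfun f) (blinfun_of_cblinfun g) = dist f g"
proof -
  have "norm (blinfun_of_cblinfun f - blinfun_of_cblinfun g) = norm (f - g)"
    by transfer simp
  then show ?thesis by (simp add: dist_norm)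
qed

lemma blinfun_apply_of_cblinfun: "blinfun_apply (blinfun_of_cblinfun f) = cblinfun_apply f"
  by transfer simp

lemma cblinfun_scaleC: "cblinfun_apply f (c *\<^sub>C x) = c *\<^sub>C cblinfun_apply f x"
  by transfer (simp add: bounded_clinear_def)

instance cblinfun :: (complex_normed_vector, complex_banach) complex_banach
proof
  fix X :: "nat \<Rightarrow> 'a \<Rightarrow>\<^sub>C\<^sub>L 'b"
  assume "Cauchy X"
  then have "Cauchy (\<lambda>n. blinfun_of_cblinfun (X n))"
    by (simp add: Cauchy_def dist_blinfun_of_cblinfun)
  then obtain L where L: "(\<lambda>n. blinfun_of_cblinfun (X n)) \<longlonglongrightarrow> L"
    using Cauchy_convergent_iff convergent_def by blast
  have pt: "(\<lambda>n. cblinfun_apply (X n) x) \<longlonglongrightarrow> blinfun_apply L x" for x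
    using blinfun.tendsto[OF L tendsto_const[of x]] by (simp add: blinfun_apply_of_cblinfun)
  have "blinfun_apply L (c *\<^sub>C x) = c *\<^sub>C blinfun_apply L x" for c x
  proof (rule LIMSEQ_unique[OF pt])
    show "(\<lambda>n. cblinfun_apply (X n) (c *\<^sub>C x)) \<longlonglongrightarrow> c *\<^sub>C blinfun_apply L x"
      using bounded_linear.tendsto[OF bounded_linear_scaleC pt[of x], of c]
      by (simp add: cblinfun_scaleC)
  qed
  then have "bounded_clinear (blinfun_apply L)"
    by (simp add: bounded_clinear_def blinfun.bounded_linear_right)
  then have "blinfun_of_cblinfun (CBlinfun (blinfun_apply L)) = L"
    by (intro blinfun_eqI) (simp add: blinfun_apply_of_cblinfun CBlinfun_inverse)
  then have "dist (X n) (CBlinfun (blinfun_apply L)) = dist (blinfun_of_cblinfun (X n)) L" for n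
    using dist_blinfun_of_cblinfun[of "X n" "CBlinfun (blinfun_apply L)"] by simp
  then have "(\<lambda>n. dist (X n) (CBlinfun (blinfun_apply L))) \<longlonglongrightarrow> 0"
    using tendsto_dist_iff[THEN iffD1, OF L] by simp
  then have "X \<longlonglongrightarrow> CBlinfun (blinfun_apply L)"
    by (rule tendsto_dist_iff[THEN iffD2])
  then show "convergent X"
    by (rule convergentI)
qed

lift_definition cblinfun_compose ::
    "('b::complex_normed_vector \<Rightarrow>\<^sub>C\<^sub>L 'c::complex_normed_vector) \<Rightarrow>
     ('a::complex_normed_vector \<Rightarrow>\<^sub>C\<^sub>L 'b) \<Rightarrow> ('a \<Rightarrow>\<^sub>C\<^sub>L 'c)" (infixl "o\<^sub>C\<^sub>L" 67)
  is "\<lambda>g f x. g (f x)"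
  by (auto simp: bounded_clinear_def intro: bounded_linear_compose)

type_synonym 'a cdual = "'a \<Rightarrow>\<^sub>C\<^sub>L complex"

text \<open>The adjoint is the Banach space adjoint: the dual is the space of linear (not conjugate
  linear) functionals, and \<open>adj T\<close> depends linearly on \<open>T\<close>.\<close>

lift_definition adj ::
    "('a::complex_normed_vector \<Rightarrow>\<^sub>C\<^sub>L 'b::complex_normed_vector) \<Rightarrow>
     ('b cdual \<Rightarrow>\<^sub>C\<^sub>L 'a cdual)"
  is "\<lambda>T \<phi>. \<phi> o\<^sub>C\<^sub>L T"
proof -
  fix T :: "'a \<Rightarrow>\<^sub>C\<^sub>L 'b"
  have comp: "norm (\<phi> o\<^sub>C\<^sub>L T) \<le> norm \<phi> * norm T" for \<phi> :: "'b cdual"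
    by transfer (auto simp: bounded_clinear_def o_def intro: onorm_compose[unfolded o_def])
  have "bounded_linear (\<lambda>\<phi> :: 'b cdual. \<phi> o\<^sub>C\<^sub>L T)"
    by (rule bounded_linear_intro[where K = "norm T"], transfer, simp, transfer, simp, rule comp)
  moreover have "(c *\<^sub>C \<phi>) o\<^sub>C\<^sub>L T = c *\<^sub>C (\<phi> o\<^sub>C\<^sub>L T)" for c and \<phi> :: "'b cdual"
    by transfer simp
  ultimately show "bounded_clinear (\<lambda>\<phi> :: 'b cdual. \<phi> o\<^sub>C\<^sub>L T)"
    by (simp add: bounded_clinear_def)
qed

lemma adj_apply: "adj T \<phi> x = \<phi> (T x)"
  by (simp add: adj.rep_eq cblinfun_compose.rep_eq)


section \<open>\<open>p\<close>-compact operators\<close>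

definition conj_exponent :: "real \<Rightarrow> real"
  where "conj_exponent p = p / (p - 1)"

lemma conj_exponent: "1 < p \<Longrightarrow> 1 / p + 1 / conj_exponent p = 1"
  by (simp add: conj_exponent_def field_simps)

definition lp_space :: "real \<Rightarrow> (nat \<Rightarrow> 'a::complex_banach) set"
  where "lp_space p = {y. summable (\<lambda>n. norm (y n) powr p)}"

definition lp_norm :: "real \<Rightarrow> (nat \<Rightarrow> 'a::complex_banach) \<Rightarrow> real"
  where "lp_norm p y = (\<Sum>n. norm (y n) powr p) powr (1 / p)"

definition lp_ball :: "real \<Rightarrow> (nat \<Rightarrow> complex) set"
  where "lp_ball p = {\<alpha> \<in> lp_space p. lp_norm p \<alpha> \<le> 1}"

text \<open>For \<open>y\<close> in \<open>lp_space p\<close> and \<open>\<alpha>\<close> in \<open>lp_space (conj_exponent p)\<close> the series converges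
  absolutely by Hoelder's inequality.\<close>

definition E_op :: "(nat \<Rightarrow> 'a::complex_banach) \<Rightarrow> (nat \<Rightarrow> complex) \<Rightarrow> 'a"
  where "E_op y \<alpha> = (\<Sum>n. \<alpha> n *\<^sub>C y n)"

definition p_bounding ::
    "real \<Rightarrow> ('a::complex_banach \<Rightarrow>\<^sub>C\<^sub>L 'b::complex_banach) \<Rightarrow> (nat \<Rightarrow> 'b) set"
  where "p_bounding p S =
    {y \<in> lp_space p. cblinfun_apply S ` cball 0 1 \<subseteq> E_op y ` lp_ball (conj_exponent p)}"

definition p_compact_ops :: "real \<Rightarrow> ('a::complex_banach \<Rightarrow>\<^sub>C\<^sub>L 'b::complex_banach) set"
  where "p_compact_ops p = {S. \<exists>y. y \<in> p_bounding p S}"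

definition kappa :: "real \<Rightarrow> ('a::complex_banach \<Rightarrow>\<^sub>C\<^sub>L 'b::complex_banach) \<Rightarrow> real"
  where "kappa p S = Inf (lp_norm p ` p_bounding p S)"

definition dual_p_compact_ops :: "real \<Rightarrow> ('a::complex_banach \<Rightarrow>\<^sub>C\<^sub>L 'b::complex_banach) set"
  where "dual_p_compact_ops p = {T. adj T \<in> p_compact_ops p}"

definition kappa_dual :: "real \<Rightarrow> ('a::complex_banach \<Rightarrow>\<^sub>C\<^sub>L 'b::complex_banach) \<Rightarrow> real"
  where "kappa_dual p T = kappa p (adj T)"


section \<open>\<open>P\<^sub>\<lambda>\<close>-spaces\<close>

text \<open>The superspaces in the definition of a \<open>P\<^sub>\<lambda>\<close>-space are quantified over inside a formula, so
  they cannot be types and are given by an explicit carrier with explicit operations.  The inclusion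
  of the space in a superspace is an isometric linear embedding.\<close>

locale complex_normed_on =
  fixes V :: "'f set" and vadd :: "'f \<Rightarrow> 'f \<Rightarrow> 'f" (infixl "\<oplus>" 65) and vzero :: 'f ("\<zero>")
    and vscale :: "complex \<Rightarrow> 'f \<Rightarrow> 'f" (infixr "\<odot>" 75) and nrm :: "'f \<Rightarrow> real"
  assumes zero_closed: "\<zero> \<in> V"
    and add_closed: "x \<in> V \<Longrightarrow> y \<in> V \<Longrightarrow> x \<oplus> y \<in> V"
    and scale_closed: "x \<in> V \<Longrightarrow> c \<odot> x \<in> V"
    and add_assoc: "x \<in> V \<Longrightarrow> y \<in> V \<Longrightarrow> z \<in> V \<Longrightarrow> (x \<oplus> y) \<oplus> z = x \<oplus> (y \<oplus> z)"
    and add_comm: "x \<in> V \<Longrightarrow> y \<in> V \<Longrightarrow> x \<oplus> y = y \<oplus> x"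
    and add_zero: "x \<in> V \<Longrightarrow> x \<oplus> \<zero> = x"
    and add_inverse: "x \<in> V \<Longrightarrow> x \<oplus> (-1) \<odot> x = \<zero>"
    and scale_add_right: "x \<in> V \<Longrightarrow> y \<in> V \<Longrightarrow> c \<odot> (x \<oplus> y) = c \<odot> x \<oplus> c \<odot> y"
    and scale_add_left: "x \<in> V \<Longrightarrow> (c + d) \<odot> x = c \<odot> x \<oplus> d \<odot> x"
    and scale_scale: "x \<in> V \<Longrightarrow> c \<odot> (d \<odot> x) = (c * d) \<odot> x"
    and scale_one: "x \<in> V \<Longrightarrow> 1 \<odot> x = x"
    and nrm_eq_0: "x \<in> V \<Longrightarrow> nrm x = 0 \<longleftrightarrow> x = \<zero>"
    and nrm_triangle: "x \<in> V \<Longrightarrow> y \<in> V \<Longrightarrow> nrm (x \<oplus> y) \<le> nrm x + nrm y"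
    and nrm_scale: "x \<in> V \<Longrightarrow> nrm (c \<odot> x) = cmod c * nrm x"

locale complex_banach_on = complex_normed_on +
  assumes complete:
    "(\<And>n. s n \<in> V) \<Longrightarrow>
     (\<And>e. e > 0 \<Longrightarrow> \<exists>N. \<forall>m\<ge>N. \<forall>n\<ge>N. nrm (s m \<oplus> (-1) \<odot> s n) < e) \<Longrightarrow>
     \<exists>x\<in>V. (\<lambda>n. nrm (s n \<oplus> (-1) \<odot> x)) \<longlonglongrightarrow> 0"

definition isometric_embedding_on ::
    "'f set \<Rightarrow> ('f \<Rightarrow> 'f \<Rightarrow> 'f) \<Rightarrow> (complex \<Rightarrow> 'f \<Rightarrow> 'f) \<Rightarrow> ('f \<Rightarrow> real)
     \<Rightarrow> ('e::complex_normed_vector \<Rightarrow> 'f) \<Rightarrow> bool"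
  where "isometric_embedding_on V vadd vscale nrm j \<longleftrightarrow>
    (\<forall>x. j x \<in> V) \<and> (\<forall>x y. j (x + y) = vadd (j x) (j y)) \<and>
    (\<forall>c x. j (c *\<^sub>C x) = vscale c (j x)) \<and> (\<forall>x. nrm (j x) = norm x)"

definition projection_on ::
    "'f set \<Rightarrow> ('f \<Rightarrow> 'f \<Rightarrow> 'f) \<Rightarrow> (complex \<Rightarrow> 'f \<Rightarrow> 'f) \<Rightarrow> ('f \<Rightarrow> real)
     \<Rightarrow> 'f set \<Rightarrow> real \<Rightarrow> ('f \<Rightarrow> 'f) \<Rightarrow> bool"
  where "projection_on V vadd vscale nrm W b P \<longleftrightarrow>
    (\<forall>x\<in>V. \<forall>y\<in>V. P (vadd x y) = vadd (P x) (P y)) \<and> (\<forall>c. \<forall>x\<in>V. P (vscale c x) = vscale c (P x)) \<and>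
    P ` V = W \<and> (\<forall>x\<in>V. P (P x) = P x) \<and> (\<forall>x\<in>V. nrm (P x) \<le> b * nrm x)"

definition P_space_in :: "'f itself \<Rightarrow> 'e::complex_banach itself \<Rightarrow> real \<Rightarrow> bool"
  where "P_space_in _ _ b \<longleftrightarrow>
    (\<forall>(V :: 'f set) vadd vzero vscale nrm (j :: 'e \<Rightarrow> 'f).
       complex_banach_on V vadd vzero vscale nrm \<longrightarrow> isometric_embedding_on V vadd vscale nrm j \<longrightarrow>
       (\<exists>P. projection_on V vadd vscale nrm (range j) b P))"

text \<open>A formula cannot quantify over all types, so the superspaces are taken on a fixed type.
  It is large enough to carry an isometric copy of \<open>\<ell>\<^sub>\<infinity>(B)\<close>, with \<open>B\<close> the unit ball of the dual
  space, and therefore the choice is immaterial: lemma \<open>P_space_imp_P_space_in\<close> at the end of this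
  theory yields the projections for superspaces of arbitrary type.\<close>

definition P_space :: "'e::complex_banach itself \<Rightarrow> real \<Rightarrow> bool"
  where "P_space E b \<longleftrightarrow> P_space_in TYPE(('e \<Rightarrow> complex) \<Rightarrow> complex) E b"

section \<open>Independence of the type of the superspaces\<close>

context complex_normed_on
begin

lemma zero_scale: "x \<in> V \<Longrightarrow> 0 \<odot> x = \<zero>"
  using nrm_scale[of x 0] nrm_eq_0[of "0 \<odot> x"] scale_closed[of x 0] by simp

lemma scale_zero: "c \<odot> \<zero> = \<zero>"
  using nrm_scale[OF zero_closed, of c] nrm_eq_0 scale_closed zero_closed
  by (metis mult_zero_right)

lemma nrm_nonneg: "x \<in> V \<Longrightarrow> 0 \<le> nrm x"
  using nrm_triangle[of x "(-1) \<odot> x"] nrm_scale[of x "-1"] add_inverse[of x] scale_closed[of x "-1"]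
    nrm_eq_0[OF zero_closed] by simp

lemma add_4: "a \<in> V \<Longrightarrow> b \<in> V \<Longrightarrow> c \<in> V \<Longrightarrow> d \<in> V \<Longrightarrow>
    (a \<oplus> b) \<oplus> (c \<oplus> d) = (a \<oplus> c) \<oplus> (b \<oplus> d)"
  by (metis add_assoc add_closed add_comm)

definition dominated_graph :: "('f \<times> real) set \<Rightarrow> bool"
  where "dominated_graph G \<longleftrightarrow>
    (\<forall>x r. (x, r) \<in> G \<longrightarrow> x \<in> V \<and> r \<le> nrm x) \<and>
    (\<forall>x r y s. (x, r) \<in> G \<longrightarrow> (y, s) \<in> G \<longrightarrow> (x \<oplus> y, r + s) \<in> G) \<and>
    (\<forall>x r t. (x, r) \<in> G \<longrightarrow> (complex_of_real t \<odot> x, t * r) \<in> G)"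

lemma dominated_graph_extend:
  assumes G: "dominated_graph G" and z: "(\<zero>, 0) \<in> G" and v: "v \<in> V"
  obtains G' c where "dominated_graph G'" "G \<subseteq> G'" "(v, c) \<in> G'"
proof -
  have GV: "x \<in> V" and Gn: "r \<le> nrm x" if "(x, r) \<in> G" for x r
    using that G by (auto simp: dominated_graph_def)
  have Ga: "(x \<oplus> y, r + s) \<in> G" if "(x, r) \<in> G" "(y, s) \<in> G" for x y r s
    using that G by (auto simp: dominated_graph_def)
  have Gs: "(complex_of_real t \<odot> x, t * r) \<in> G" if "(x, r) \<in> G" for x r t
    using that G by (auto simp: dominated_graph_def)
  define w where "w = (-1) \<odot> v"
  have w: "w \<in> V" by (simp add: w_def scale_closed v)
  define S where "S = {r - nrm (x \<oplus> w) |x r. (x, r) \<in> G}"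
  have key: "r - nrm (x \<oplus> w) \<le> nrm (y \<oplus> v) - s" if "(x, r) \<in> G" "(y, s) \<in> G" for x r y s
  proof -
    have "r + s \<le> nrm (x \<oplus> y)" using Gn[OF Ga[OF that]] .
    also have "x \<oplus> y = (x \<oplus> w) \<oplus> (y \<oplus> v)"
      using add_4[of x y w v] add_4[of x w y v] GV[OF that(1)] GV[OF that(2)] v w
        add_inverse[of v] add_comm[of v w] add_zero add_closed by (simp add: w_def)
    also have "nrm \<dots> \<le> nrm (x \<oplus> w) + nrm (y \<oplus> v)"
      by (intro nrm_triangle add_closed GV[OF that(1)] GV[OF that(2)] v w)
    finally show ?thesis by simp
  qed
  have Sne: "S \<noteq> {}" using z by (auto simp: S_def)
  have Sbdd: "bdd_above S" using key[OF _ z] by (auto simp: S_def bdd_above_def)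
  define c where "c = Sup S"
  have c1: "r - c \<le> nrm (x \<oplus> w)" if "(x, r) \<in> G" for x r
  proof -
    have "r - nrm (x \<oplus> w) \<le> c"
      unfolding c_def by (rule cSup_upper[OF _ Sbdd]) (use that in \<open>auto simp: S_def\<close>)
    then show ?thesis by simp
  qed
  have c2: "s + c \<le> nrm (y \<oplus> v)" if "(y, s) \<in> G" for y s
  proof -
    have "c \<le> nrm (y \<oplus> v) - s"
      unfolding c_def by (rule cSup_least[OF Sne]) (use key[OF _ that] in \<open>auto simp: S_def\<close>)
    then show ?thesis by simp
  qed
  have bound: "r + t * c \<le> nrm (x \<oplus> complex_of_real t \<odot> v)" if xr: "(x, r) \<in> G" for x r t
  proof -
    have scl: "r + s * b \<le> nrm (x \<oplus> complex_of_real s \<odot> e)"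
      if s: "s > 0" and e: "e \<in> V"
        and le: "r / s + b \<le> nrm (complex_of_real (1 / s) \<odot> x \<oplus> e)" for s b e
    proof -
      let ?y = "complex_of_real (1 / s) \<odot> x \<oplus> e"
      have y: "?y \<in> V" by (intro add_closed scale_closed GV[OF xr] e)
      have "x \<oplus> complex_of_real s \<odot> e = complex_of_real s \<odot> ?y"
        using s GV[OF xr] e
        by (simp add: scale_add_right scale_closed scale_scale scale_one flip: of_real_mult)
      then have "nrm (x \<oplus> complex_of_real s \<odot> e) = s * nrm ?y"
        using nrm_scale[OF y] s by simp
      then have "s * (r / s + b) \<le> nrm (x \<oplus> complex_of_real s \<odot> e)"
        using mult_left_mono[OF le, of s] s by simp
      then show ?thesis using s by (simp add: distrib_left)
    qed
    consider "t = 0" | "t > 0" | "t < 0" by linarith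
    then show ?thesis
    proof cases
      case 1
      then show ?thesis using Gn[OF xr] by (simp add: zero_scale v add_zero GV[OF xr])
    next
      case 2
      then show ?thesis
        using c2[OF Gs[OF xr, of "1 / t"]] by (intro scl) (simp_all add: v)
    next
      case 3
      then have "r + (- t) * (- c) \<le> nrm (x \<oplus> complex_of_real (- t) \<odot> w)"
        using c1[OF Gs[OF xr, of "1 / (- t)"]] by (intro scl) (simp_all add: w)
      moreover have "complex_of_real (- t) \<odot> w = complex_of_real t \<odot> v"
        by (simp add: w_def scale_scale v)
      ultimately show ?thesis by simp
    qed
  qed
  define G' where "G' = {(x \<oplus> complex_of_real t \<odot> v, r + t * c) |x r t. (x, r) \<in> G}"
  have "dominated_graph G'"
    unfolding dominated_graph_def
  proof (intro conjI allI impI)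
    fix x r assume "(x, r) \<in> G'"
    then show "x \<in> V" "r \<le> nrm x"
      using bound GV v by (auto simp: G'_def intro!: add_closed scale_closed)
  next
    fix x r y s assume "(x, r) \<in> G'" "(y, s) \<in> G'"
    then obtain x1 r1 t1 y1 s1 t2 where *: "(x1, r1) \<in> G" "(y1, s1) \<in> G"
      "x = x1 \<oplus> complex_of_real t1 \<odot> v" "r = r1 + t1 * c"
      "y = y1 \<oplus> complex_of_real t2 \<odot> v" "s = s1 + t2 * c"
      by (auto simp: G'_def)
    have "x \<oplus> y = (x1 \<oplus> y1) \<oplus> complex_of_real (t1 + t2) \<odot> v"
      using * GV v by (simp add: add_4 scale_closed scale_add_left)
    moreover have "r + s = (r1 + s1) + (t1 + t2) * c"
      using * by (simp add: algebra_simps)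
    ultimately show "(x \<oplus> y, r + s) \<in> G'"
      using Ga[OF *(1,2)] unfolding G'_def by blast
  next
    fix x r t assume "(x, r) \<in> G'"
    then obtain x1 r1 t1 where *: "(x1, r1) \<in> G"
      "x = x1 \<oplus> complex_of_real t1 \<odot> v" "r = r1 + t1 * c"
      by (auto simp: G'_def)
    have "complex_of_real t \<odot> x = complex_of_real t \<odot> x1 \<oplus> complex_of_real (t * t1) \<odot> v"
      using * GV v by (simp add: scale_add_right scale_closed scale_scale)
    moreover have "t * r = t * r1 + (t * t1) * c"
      using * by (simp add: algebra_simps)
    ultimately show "(complex_of_real t \<odot> x, t * r) \<in> G'"
      using Gs[OF *(1), of t] unfolding G'_def by blast
  qed
  moreover have "G \<subseteq> G'"
  proof
    fix q assume q: "q \<in> G"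
    obtain x r where "q = (x, r)" by (cases q)
    with q have "q = (x \<oplus> complex_of_real 0 \<odot> v, r + 0 * c)"
      by (simp add: zero_scale v add_zero GV)
    with q \<open>q = (x, r)\<close> show "q \<in> G'" unfolding G'_def by blast
  qed
  moreover have "(v, c) \<in> G'"
  proof -
    have "v = \<zero> \<oplus> complex_of_real 1 \<odot> v"
      using add_zero[OF v] add_comm[OF zero_closed v] by (simp add: scale_one v)
    moreover have "c = 0 + 1 * c" by simp
    ultimately show ?thesis using z unfolding G'_def by blast
  qed
  ultimately show thesis using that by blast
qed

lemma hahn_banach_real:
  assumes G0: "dominated_graph G0" and z: "(\<zero>, 0) \<in> G0"
  obtains g where "\<And>x r. (x, r) \<in> G0 \<Longrightarrow> g x = r"
    and "\<And>x y. x \<in> V \<Longrightarrow> y \<in> V \<Longrightarrow> g (x \<oplus> y) = g x + g y"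
    and "\<And>x t. x \<in> V \<Longrightarrow> g (complex_of_real t \<odot> x) = t * g x"
    and "\<And>x. x \<in> V \<Longrightarrow> g x \<le> nrm x"
proof -
  define A where "A = {G. dominated_graph G \<and> G0 \<subseteq> G}"
  have "\<exists>M\<in>A. \<forall>X\<in>A. M \<subseteq> X \<longrightarrow> X = M"
  proof (rule subset_Zorn_nonempty)
    show "A \<noteq> {}" using G0 by (auto simp: A_def)
    fix C assume C: "C \<noteq> {}" "subset.chain A C"
    have CA: "dominated_graph G \<and> G0 \<subseteq> G" if "G \<in> C" for G
      using that C(2) by (auto simp: A_def subset_chain_def)
    have "dominated_graph (\<Union>C)"
      unfolding dominated_graph_def
    proof (intro conjI allI impI)
      fix x r assume "(x, r) \<in> \<Union>C"
      then show "x \<in> V" "r \<le> nrm x" using CA by (auto simp: dominated_graph_def)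
    next
      fix x r y s assume "(x, r) \<in> \<Union>C" "(y, s) \<in> \<Union>C"
      then obtain G1 G2 where G12: "G1 \<in> C" "G2 \<in> C" "(x, r) \<in> G1" "(y, s) \<in> G2" by auto
      then have "G1 \<subseteq> G2 \<or> G2 \<subseteq> G1" using C(2) by (auto simp: subset_chain_def)
      then obtain G where "G \<in> C" "(x, r) \<in> G" "(y, s) \<in> G" using G12 by auto
      then have "G \<in> C \<and> (x \<oplus> y, r + s) \<in> G" using CA by (auto simp: dominated_graph_def)
      then show "(x \<oplus> y, r + s) \<in> \<Union>C" by blast
    next
      fix x r t assume "(x, r) \<in> \<Union>C"
      then obtain G where "G \<in> C" "(x, r) \<in> G" by auto
      then have "G \<in> C \<and> (complex_of_real t \<odot> x, t * r) \<in> G"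
        using CA by (auto simp: dominated_graph_def)
      then show "(complex_of_real t \<odot> x, t * r) \<in> \<Union>C" by blast
    qed
    then show "\<Union>C \<in> A" using C(1) CA by (auto simp: A_def)
  qed
  then obtain G where G: "dominated_graph G" "G0 \<subseteq> G"
    and max: "\<And>X. dominated_graph X \<Longrightarrow> G0 \<subseteq> X \<Longrightarrow> G \<subseteq> X \<Longrightarrow> X = G"
    by (auto simp: A_def)
  have Gz: "(\<zero>, 0) \<in> G" using z G(2) by auto
  have ex: "\<exists>r. (v, r) \<in> G" if "v \<in> V" for v
  proof -
    from dominated_graph_extend[OF G(1) Gz that] obtain G' c where
      "dominated_graph G'" "G \<subseteq> G'" "(v, c) \<in> G'" by blast
    with max[of G'] G(2) show ?thesis by auto
  qed
  have GV: "x \<in> V" and Gn: "r \<le> nrm x" if "(x, r) \<in> G" for x r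
    using that G by (auto simp: dominated_graph_def)
  have Ga: "(x \<oplus> y, r + s) \<in> G" if "(x, r) \<in> G" "(y, s) \<in> G" for x y r s
    using that G by (auto simp: dominated_graph_def)
  have Gs: "(complex_of_real t \<odot> x, t * r) \<in> G" if "(x, r) \<in> G" for x r t
    using that G by (auto simp: dominated_graph_def)
  have le: "r \<le> s" if "(x, r) \<in> G" "(x, s) \<in> G" for x r s
  proof -
    have "(x \<oplus> complex_of_real (-1) \<odot> x, r + (-1) * s) \<in> G"
      using Ga[OF that(1) Gs[OF that(2)]] .
    then have "(\<zero>, r - s) \<in> G" using add_inverse[OF GV[OF that(1)]] by simp
    from Gn[OF this] show ?thesis using nrm_eq_0[OF zero_closed] by simp
  qed
  define g where "g x = (SOME r. (x, r) \<in> G)" for x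
  have gG: "(x, g x) \<in> G" if "x \<in> V" for x
    unfolding g_def using ex[OF that] by (rule someI_ex)
  have geq: "g x = r" if "(x, r) \<in> G" for x r
    using le[OF gG that] le[OF that gG] GV[OF that] by fastforce
  show thesis
  proof (rule that)
    show "g x = r" if "(x, r) \<in> G0" for x r using that G(2) geq by auto
    show "g (x \<oplus> y) = g x + g y" if "x \<in> V" "y \<in> V" for x y
      by (intro geq Ga gG that)
    show "g (complex_of_real t \<odot> x) = t * g x" if "x \<in> V" for x t
      by (intro geq Gs gG that)
    show "g x \<le> nrm x" if "x \<in> V" for x
      by (rule Gn[OF gG[OF that]])
  qed
qed

lemma hahn_banach_complex:
  assumes HV: "\<And>x r. (x, r) \<in> H \<Longrightarrow> x \<in> V \<and> cmod r \<le> nrm x"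
    and Ha: "\<And>x r y s. (x, r) \<in> H \<Longrightarrow> (y, s) \<in> H \<Longrightarrow> (x \<oplus> y, r + s) \<in> H"
    and Hs: "\<And>x r c. (x, r) \<in> H \<Longrightarrow> (c \<odot> x, c * r) \<in> H"
    and ne: "H \<noteq> {}"
  obtains h where "\<And>x r. (x, r) \<in> H \<Longrightarrow> h x = r"
    and "\<And>x y. x \<in> V \<Longrightarrow> y \<in> V \<Longrightarrow> h (x \<oplus> y) = h x + h y"
    and "\<And>x c. x \<in> V \<Longrightarrow> h (c \<odot> x) = c * h x"
    and "\<And>x. x \<in> V \<Longrightarrow> cmod (h x) \<le> nrm x"
proof -
  define G0 where "G0 = {(x, Re r) |x r. (x, r) \<in> H}"
  obtain x0 r0 where "(x0, r0) \<in> H" using ne by auto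
  from Hs[OF this, of 0] have "(\<zero>, 0) \<in> H" using HV[OF \<open>(x0, r0) \<in> H\<close>] by (simp add: zero_scale)
  then have z: "(\<zero>, 0) \<in> G0" unfolding G0_def by force
  have G0: "dominated_graph G0"
    unfolding dominated_graph_def
  proof (intro conjI allI impI)
    fix x r assume "(x, r) \<in> G0"
    then obtain q where "(x, q) \<in> H" "r = Re q" by (auto simp: G0_def)
    then show "x \<in> V" "r \<le> nrm x" using HV complex_Re_le_cmod order_trans by blast+
  next
    fix x r y s assume "(x, r) \<in> G0" "(y, s) \<in> G0"
    then obtain q q' where "(x, q) \<in> H" "r = Re q" "(y, q') \<in> H" "s = Re q'" by (auto simp: G0_def)
    then have "(x \<oplus> y, q + q') \<in> H" "r + s = Re (q + q')" using Ha by auto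
    then show "(x \<oplus> y, r + s) \<in> G0" unfolding G0_def by blast
  next
    fix x r t assume "(x, r) \<in> G0"
    then obtain q where "(x, q) \<in> H" "r = Re q" by (auto simp: G0_def)
    then have "(complex_of_real t \<odot> x, complex_of_real t * q) \<in> H" "t * r = Re (complex_of_real t * q)"
      using Hs by auto
    then show "(complex_of_real t \<odot> x, t * r) \<in> G0" unfolding G0_def by blast
  qed
  obtain g where gG: "\<And>x r. (x, r) \<in> G0 \<Longrightarrow> g x = r"
    and ga: "\<And>x y. x \<in> V \<Longrightarrow> y \<in> V \<Longrightarrow> g (x \<oplus> y) = g x + g y"
    and gs: "\<And>x t. x \<in> V \<Longrightarrow> g (complex_of_real t \<odot> x) = t * g x"
    and gn: "\<And>x. x \<in> V \<Longrightarrow> g x \<le> nrm x"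
    by (rule hahn_banach_real[OF G0 z]) blast
  define h where "h x = Complex (g x) (- g (\<i> \<odot> x))" for x
  have hs: "h (c \<odot> x) = c * h x" if x: "x \<in> V" for x c
  proof -
    have c: "c = complex_of_real (Re c) + complex_of_real (Im c) * \<i>"
      by (simp add: complex_eq_iff)
    have ic: "\<i> * c = complex_of_real (Re c) * \<i> + complex_of_real (- Im c)"
      by (simp add: complex_eq_iff)
    have "c \<odot> x = complex_of_real (Re c) \<odot> x \<oplus> complex_of_real (Im c) \<odot> \<i> \<odot> x"
      by (subst c) (simp add: scale_add_left scale_scale x)
    then have 1: "g (c \<odot> x) = Re c * g x + Im c * g (\<i> \<odot> x)"
      using x by (simp add: ga gs scale_closed)
    have "\<i> \<odot> c \<odot> x = complex_of_real (Re c) \<odot> \<i> \<odot> x \<oplus> complex_of_real (- Im c) \<odot> x"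
      unfolding scale_scale[OF x] by (subst ic) (simp only: scale_add_left x)
    then have 2: "g (\<i> \<odot> c \<odot> x) = Re c * g (\<i> \<odot> x) - Im c * g x"
      using x ga[of "complex_of_real (Re c) \<odot> \<i> \<odot> x" "complex_of_real (- Im c) \<odot> x"]
        gs[of x "- Im c"] by (simp add: gs scale_closed)
    show ?thesis by (simp add: h_def 1 2 complex_eq_iff algebra_simps)
  qed
  show thesis
  proof (rule that)
    show "h x = r" if "(x, r) \<in> H" for x r
    proof -
      have "(x, Re r) \<in> G0" "(\<i> \<odot> x, Re (\<i> * r)) \<in> G0"
        using that Hs[OF that, of \<i>] unfolding G0_def by blast+
      then have "g x = Re r" "g (\<i> \<odot> x) = Re (\<i> * r)" by (simp_all only: gG)
      then show ?thesis by (simp add: h_def complex_eq_iff)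
    qed
    show "h (x \<oplus> y) = h x + h y" if "x \<in> V" "y \<in> V" for x y
      using that by (simp add: h_def scale_add_right ga scale_closed complex_eq_iff)
    show "h (c \<odot> x) = c * h x" if "x \<in> V" for x c by (rule hs[OF that])
    show "cmod (h x) \<le> nrm x" if x: "x \<in> V" for x
    proof -
      define c where "c = cnj (sgn (h x))"
      have c1: "cmod c \<le> 1" by (simp add: c_def norm_sgn)
      have "c * h x = complex_of_real (cmod (h x))"
      proof (cases "h x = 0")
        case False
        have "c * h x = h x * cnj (h x) / complex_of_real (cmod (h x))"
          by (simp add: c_def sgn_eq)
        also have "h x * cnj (h x) = (complex_of_real (cmod (h x)))\<^sup>2"
          using complex_norm_square[of "h x"] by simp
        finally show ?thesis using False by (simp add: power2_eq_square)
      qed simp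
      then have "cmod (h x) = Re (h (c \<odot> x))" by (simp add: hs x)
      also have "\<dots> = g (c \<odot> x)" by (simp add: h_def)
      also have "\<dots> \<le> nrm (c \<odot> x)" by (intro gn scale_closed x)
      also have "\<dots> \<le> nrm x"
        using mult_right_mono[OF c1 nrm_nonneg[OF x]] by (simp add: nrm_scale x)
      finally show ?thesis .
    qed
  qed
qed

end

lemma complex_normed_on_UNIV:
  "complex_normed_on (UNIV :: 'e::complex_normed_vector set) (+) 0 (*\<^sub>C) norm"
proof
  fix x :: 'e
  show "x + (- 1) *\<^sub>C x = 0"
    using scaleR_scaleC[of "-1" x] by (metis add.right_inverse of_real_1 of_real_minus scaleR_minus1_left)
qed (simp_all add: scaleC_add_right scaleC_add_left scaleC_scaleC scaleC_one norm_scaleC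
    norm_triangle_ineq add.assoc add.commute)

lemma ex_norming_functional:
  fixes e :: "'e::complex_normed_vector"
  obtains h where "\<And>x y. h (x + y) = h x + h y" "\<And>c x. h (c *\<^sub>C x) = c * h x"
    "\<And>x. cmod (h x) \<le> norm x" "h e = complex_of_real (norm e)"
proof -
  interpret complex_normed_on "UNIV :: 'e set" "(+)" 0 "(*\<^sub>C)" norm
    by (rule complex_normed_on_UNIV)
  define H where "H = {(c *\<^sub>C e, c * complex_of_real (norm e)) |c. True}"
  obtain h where hH: "\<And>x r. (x, r) \<in> H \<Longrightarrow> h x = r"
    and ha: "\<And>x y. x \<in> UNIV \<Longrightarrow> y \<in> UNIV \<Longrightarrow> h (x + y) = h x + h y"
    and hs: "\<And>x c. x \<in> UNIV \<Longrightarrow> h (c *\<^sub>C x) = c * h x"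
    and hn: "\<And>x. x \<in> UNIV \<Longrightarrow> cmod (h x) \<le> norm x"
  proof (rule hahn_banach_complex[of H])
    fix x y r s c
    show "x \<in> UNIV \<and> cmod r \<le> norm x" if "(x, r) \<in> H"
      using that by (auto simp: H_def norm_scaleC norm_mult)
    show "(x + y, r + s) \<in> H" if "(x, r) \<in> H" "(y, s) \<in> H"
      using that by (auto simp: H_def simp flip: scaleC_add_left distrib_right)
    show "(c *\<^sub>C x, c * r) \<in> H" if "(x, r) \<in> H"
      using that by (auto simp: H_def scaleC_scaleC simp flip: mult.assoc)
    show "H \<noteq> {}" by (auto simp: H_def)
  qed blast
  have eH: "(e, complex_of_real (norm e)) \<in> H"
    unfolding H_def using scaleC_one[of e] by force
  show thesis
    by (rule that[of h]) (simp_all add: ha hs hn hH[OF eH])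
qed

lemma complex_banach_on_bounded_functions:
  "complex_banach_on {g :: 'i \<Rightarrow> complex. bounded (range g)}
     (\<lambda>f g i. f i + g i) (\<lambda>i. 0) (\<lambda>c g i. c * g i) (\<lambda>g. SUP i. cmod (g i))"
proof -
  let ?V = "{g :: 'i \<Rightarrow> complex. bounded (range g)}"
  let ?n = "\<lambda>g :: 'i \<Rightarrow> complex. SUP i. cmod (g i)"
  have bdd: "bdd_above (range (\<lambda>i. cmod (g i)))" if "g \<in> ?V" for g
    using that by (auto simp: bounded_iff bdd_above_def)
  have up: "cmod (g i) \<le> ?n g" if "g \<in> ?V" for g i
    by (rule cSUP_upper[OF _ bdd[OF that]]) simp
  have least: "?n g \<le> B" if "\<And>i. cmod (g i) \<le> B" for g B
    by (rule cSUP_least) (simp_all add: that)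
  have mem: "g \<in> ?V" if "\<And>i. cmod (g i) \<le> B" for g B
    using that by (auto simp: bounded_iff)
  have addV: "(\<lambda>i. f i + g i) \<in> ?V" if "f \<in> ?V" "g \<in> ?V" for f g
    by (rule mem[of _ "?n f + ?n g"])
      (intro norm_triangle_le add_mono up that)
  have sclV: "(\<lambda>i. c * f i) \<in> ?V" if "f \<in> ?V" for f c
    by (rule mem[of _ "cmod c * ?n f"]) (simp add: norm_mult mult_left_mono up[OF that])
  have scl_le: "?n (\<lambda>i. c * f i) \<le> cmod c * ?n f" if "f \<in> ?V" for f c
    by (rule least) (simp add: norm_mult mult_left_mono up[OF that])
  interpret complex_normed_on ?V "\<lambda>f g i. f i + g i" "\<lambda>i. 0" "\<lambda>c g i. c * g i" ?n
  proof
    show "(\<lambda>i. 0) \<in> ?V" by (rule mem[of _ 0]) simp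
  next
    fix f g assume f: "f \<in> ?V" and g: "g \<in> ?V"
    show "(\<lambda>i. f i + g i) \<in> ?V" by (rule addV[OF f g])
    show "?n (\<lambda>i. f i + g i) \<le> ?n f + ?n g"
      by (rule least) (intro norm_triangle_le add_mono up f g)
  next
    fix f c assume f: "f \<in> ?V"
    show "(\<lambda>i. c * f i) \<in> ?V" by (rule sclV[OF f])
    show "?n f = 0 \<longleftrightarrow> f = (\<lambda>i. 0)"
      using up[OF f] by (auto simp: fun_eq_iff)
    show "?n (\<lambda>i. c * f i) = cmod c * ?n f"
    proof (cases "c = 0")
      case False
      have "?n (\<lambda>i. inverse c * (c * f i)) \<le> cmod (inverse c) * ?n (\<lambda>i. c * f i)"
        by (rule scl_le[OF sclV[OF f]])
      then have "?n f \<le> cmod (inverse c) * ?n (\<lambda>i. c * f i)"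
        using False by (simp add: mult.assoc[symmetric])
      then have "cmod c * ?n f \<le> ?n (\<lambda>i. c * f i)"
        using False by (simp add: norm_inverse norm_divide field_simps)
      with scl_le[OF f, of c] show ?thesis by simp
    qed simp
  qed (auto simp: algebra_simps)
  show ?thesis
  proof
    fix s :: "nat \<Rightarrow> 'i \<Rightarrow> complex"
    assume sV: "\<And>n. s n \<in> ?V"
      and Cau: "\<And>e. e > 0 \<Longrightarrow> \<exists>N. \<forall>m\<ge>N. \<forall>n\<ge>N. ?n (\<lambda>i. s m i + (- 1) * s n i) < e"
    have diffV: "(\<lambda>i. f i + (-1) * g i) \<in> ?V" if "f \<in> ?V" "g \<in> ?V" for f g
      by (intro addV sclV that)
    have unif: "\<exists>N. \<forall>m\<ge>N. \<forall>n\<ge>N. \<forall>i. cmod (s m i - s n i) < e" if "e > 0" for e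
    proof -
      obtain N where N: "\<forall>m\<ge>N. \<forall>n\<ge>N. ?n (\<lambda>i. s m i + (- 1) * s n i) < e"
        using Cau[OF \<open>e > 0\<close>] by blast
      have "cmod (s m i - s n i) < e" if "m \<ge> N" "n \<ge> N" for m n i
      proof -
        have "cmod (s m i + (- 1) * s n i) \<le> ?n (\<lambda>i. s m i + (- 1) * s n i)"
          by (rule up[OF diffV[OF sV sV]])
        also have "\<dots> < e" using N that by blast
        finally show ?thesis by simp
      qed
      then show ?thesis by blast
    qed
    have "Cauchy (\<lambda>n. s n i)" for i
      unfolding Cauchy_def dist_norm using unif by blast
    then have "\<exists>l. (\<lambda>n. s n i) \<longlonglongrightarrow> l" for i
      using Cauchy_convergent_iff convergent_def by blast
    then obtain l where l: "\<And>i. (\<lambda>n. s n i) \<longlonglongrightarrow> l i" by metis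
    have lim: "\<exists>N. \<forall>m\<ge>N. \<forall>i. cmod (s m i - l i) \<le> e" if "e > 0" for e
    proof -
      obtain N where N: "\<And>m n i. m \<ge> N \<Longrightarrow> n \<ge> N \<Longrightarrow> cmod (s m i - s n i) < e"
        using unif[OF \<open>e > 0\<close>] by blast
      have "cmod (s m i - l i) \<le> e" if "m \<ge> N" for m i
      proof (rule tendsto_upperbound)
        show "(\<lambda>n. cmod (s m i - s n i)) \<longlonglongrightarrow> cmod (s m i - l i)"
          by (intro tendsto_intros l)
        show "\<forall>\<^sub>F n in sequentially. cmod (s m i - s n i) \<le> e"
          using N[OF that] by (auto simp: eventually_sequentially intro: less_imp_le)
      qed simp
      then show ?thesis by blast
    qed
    obtain N where N: "\<And>i. cmod (s N i - l i) \<le> 1"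
      using lim[of 1] by auto
    have "cmod (l i) \<le> ?n (s N) + 1" for i
      using norm_triangle_ineq4[of "s N i" "s N i - l i"] N[of i] up[OF sV, of N i] by simp
    then have "l \<in> ?V" by (rule mem)
    moreover have "(\<lambda>n. ?n (\<lambda>i. s n i + (- 1) * l i)) \<longlonglongrightarrow> 0"
    proof (rule LIMSEQ_I)
      fix e :: real assume e: "e > 0"
      then obtain N where N: "\<And>m i. m \<ge> N \<Longrightarrow> cmod (s m i - l i) \<le> e / 2"
        using lim[of "e / 2"] by auto
      have "norm (?n (\<lambda>i. s m i + (- 1) * l i) - 0) < e" if "m \<ge> N" for m
      proof -
        have "?n (\<lambda>i. s m i + (- 1) * l i) \<le> e / 2"
          by (rule least) (use N[OF that] in simp)
        moreover have "0 \<le> ?n (\<lambda>i. s m i + (- 1) * l i)"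
          by (rule nrm_nonneg[OF diffV[OF sV \<open>l \<in> ?V\<close>]])
        ultimately show ?thesis using e by simp
      qed
      then show "\<exists>no. \<forall>n\<ge>no. norm (?n (\<lambda>i. s n i + (- 1) * l i) - 0) < e" by blast
    qed
    ultimately show "\<exists>x\<in>?V. (\<lambda>n. ?n (\<lambda>i. s n i + (- 1) * x i)) \<longlonglongrightarrow> 0" by blast
  qed
qed

theorem P_space_imp_P_space_in:
  assumes P: "P_space TYPE('e::complex_banach) b"
  shows "P_space_in TYPE('f) TYPE('e) b"
  unfolding P_space_in_def
proof (intro allI impI)
  fix V :: "'f set" and vadd vzero vscale nrm and j :: "'e \<Rightarrow> 'f"
  assume "complex_banach_on V vadd vzero vscale nrm" and emb: "isometric_embedding_on V vadd vscale nrm j"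
  then interpret complex_banach_on V vadd vzero vscale nrm by simp
  have jV: "j x \<in> V" and ja: "j (x + y) = vadd (j x) (j y)"
    and js: "j (c *\<^sub>C x) = vscale c (j x)" and jn: "nrm (j x) = norm x" for x y c
    using emb by (auto simp: isometric_embedding_on_def)
  define B where "B = {\<phi> :: 'e \<Rightarrow> complex. (\<forall>x y. \<phi> (x + y) = \<phi> x + \<phi> y) \<and>
    (\<forall>c x. \<phi> (c *\<^sub>C x) = c * \<phi> x) \<and> (\<forall>x. cmod (\<phi> x) \<le> norm x)}"
  have "\<exists>h. (\<forall>x. h (j x) = \<phi> x) \<and> (\<forall>x\<in>V. \<forall>y\<in>V. h (vadd x y) = h x + h y) \<and>
      (\<forall>c. \<forall>x\<in>V. h (vscale c x) = c * h x) \<and> (\<forall>x\<in>V. cmod (h x) \<le> nrm x)"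
    if \<phi>: "\<phi> \<in> B" for \<phi>
  proof -
    define H where "H = {(j x, \<phi> x) |x. True}"
    obtain h where "\<And>x r. (x, r) \<in> H \<Longrightarrow> h x = r"
      and "\<And>x y. x \<in> V \<Longrightarrow> y \<in> V \<Longrightarrow> h (vadd x y) = h x + h y"
      and "\<And>x c. x \<in> V \<Longrightarrow> h (vscale c x) = c * h x"
      and "\<And>x. x \<in> V \<Longrightarrow> cmod (h x) \<le> nrm x"
    proof (rule hahn_banach_complex[of H])
      fix x y r s c
      show "x \<in> V \<and> cmod r \<le> nrm x" if "(x, r) \<in> H"
        using that \<phi> by (auto simp: H_def jV jn B_def)
      show "(vadd x y, r + s) \<in> H" if "(x, r) \<in> H" "(y, s) \<in> H"
      proof -
        obtain x' y' where "x = j x'" "r = \<phi> x'" "y = j y'" "s = \<phi> y'"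
          using \<open>(x, r) \<in> H\<close> \<open>(y, s) \<in> H\<close> by (auto simp: H_def)
        then have "(vadd x y, r + s) = (j (x' + y'), \<phi> (x' + y'))"
          using \<phi> by (simp add: ja B_def)
        then show ?thesis unfolding H_def by blast
      qed
      show "(vscale c x, c * r) \<in> H" if "(x, r) \<in> H"
      proof -
        obtain x' where "x = j x'" "r = \<phi> x'" using \<open>(x, r) \<in> H\<close> by (auto simp: H_def)
        then have "(vscale c x, c * r) = (j (c *\<^sub>C x'), \<phi> (c *\<^sub>C x'))"
          using \<phi> by (simp add: js B_def)
        then show ?thesis unfolding H_def by blast
      qed
      show "H \<noteq> {}" by (auto simp: H_def)
    qed blast
    then show ?thesis by (intro exI[of _ h]) (auto simp: H_def)
  qed
  then have "\<forall>\<phi>\<in>B. \<exists>h. (\<forall>x. h (j x) = \<phi> x) \<and> (\<forall>x\<in>V. \<forall>y\<in>V. h (vadd x y) = h x + h y) \<and>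
      (\<forall>c. \<forall>x\<in>V. h (vscale c x) = c * h x) \<and> (\<forall>x\<in>V. cmod (h x) \<le> nrm x)"
    by blast
  from bchoice[OF this] obtain \<Psi> where
    \<Psi>: "\<forall>\<phi>\<in>B. (\<forall>x. \<Psi> \<phi> (j x) = \<phi> x) \<and>
      (\<forall>x\<in>V. \<forall>y\<in>V. \<Psi> \<phi> (vadd x y) = \<Psi> \<phi> x + \<Psi> \<phi> y) \<and>
      (\<forall>c. \<forall>x\<in>V. \<Psi> \<phi> (vscale c x) = c * \<Psi> \<phi> x) \<and> (\<forall>x\<in>V. cmod (\<Psi> \<phi> x) \<le> nrm x)"
    by blast
  let ?V = "{g :: ('e \<Rightarrow> complex) \<Rightarrow> complex. bounded (range g)}"
  let ?n = "\<lambda>g :: ('e \<Rightarrow> complex) \<Rightarrow> complex. SUP i. cmod (g i)"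
  interpret L: complex_banach_on ?V "\<lambda>f g i. f i + g i" "\<lambda>i. 0" "\<lambda>c g i. c * g i" ?n
    by (rule complex_banach_on_bounded_functions)
  define Q where "Q v \<phi> = (if \<phi> \<in> B then \<Psi> \<phi> v else 0)" for v \<phi>
  have Qb: "cmod (Q v \<phi>) \<le> nrm v" if "v \<in> V" for v \<phi>
    using that by (simp add: Q_def \<Psi> nrm_nonneg)
  have QV: "Q v \<in> ?V" if "v \<in> V" for v
    using Qb[OF that] by (auto simp: bounded_iff)
  have Qn: "?n (Q v) \<le> nrm v" if "v \<in> V" for v
    by (rule cSUP_least) (simp_all add: Qb that)
  have Qa: "Q (vadd v w) = (\<lambda>\<phi>. Q v \<phi> + Q w \<phi>)" if "v \<in> V" "w \<in> V" for v w
    using that by (auto simp: Q_def \<Psi>)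
  have Qs: "Q (vscale c v) = (\<lambda>\<phi>. c * Q v \<phi>)" if "v \<in> V" for c v
    using that by (auto simp: Q_def \<Psi>)
  define k where "k x = Q (j x)" for x
  have kn: "?n (k x) = norm x" for x
  proof (rule antisym)
    show "?n (k x) \<le> norm x" using Qn[OF jV[of x]] by (simp add: k_def jn)
    obtain h where "\<And>x y. h (x + y) = h x + h y" "\<And>c x. h (c *\<^sub>C x) = c * h x"
      "\<And>x. cmod (h x) \<le> norm x" and hx: "h x = complex_of_real (norm x)"
      using ex_norming_functional[of x] by blast
    then have hB: "h \<in> B" by (auto simp: B_def)
    then have "norm x = cmod (k x h)" by (simp add: k_def Q_def \<Psi> hx)
    also have "\<dots> \<le> ?n (k x)"
      using QV[OF jV[of x]]
      by (intro cSUP_upper) (auto simp: k_def bounded_iff bdd_above_def)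
    finally show "norm x \<le> ?n (k x)" .
  qed
  have "isometric_embedding_on ?V (\<lambda>f g i. f i + g i) (\<lambda>c g i. c * g i) ?n k"
    unfolding isometric_embedding_on_def using QV[OF jV]
    by (simp add: kn) (simp add: k_def ja js Qa Qs jV)
  moreover have "P_space_in TYPE(('e \<Rightarrow> complex) \<Rightarrow> complex) TYPE('e) b"
    using P by (simp add: P_space_def)
  ultimately obtain P0
    where P0: "projection_on ?V (\<lambda>f g i. f i + g i) (\<lambda>c g i. c * g i) ?n (range k) b P0"
    unfolding P_space_in_def using L.complex_banach_on_axioms by blast
  have P0a: "P0 (\<lambda>i. f i + g i) = (\<lambda>i. P0 f i + P0 g i)" if "f \<in> ?V" "g \<in> ?V" for f g
    using P0 that unfolding projection_on_def by blast
  have P0s: "P0 (\<lambda>i. c * f i) = (\<lambda>i. c * P0 f i)" if "f \<in> ?V" for c f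
    using P0 that unfolding projection_on_def by blast
  have P0i: "P0 (P0 f) = P0 f" if "f \<in> ?V" for f
    using P0 that unfolding projection_on_def by blast
  have P0r: "P0 ` ?V = range k"
    using P0 unfolding projection_on_def by blast
  have P0n: "?n (P0 f) \<le> b * ?n f" if "f \<in> ?V" for f
    using P0 that unfolding projection_on_def by blast
  have b: "0 \<le> b"
  proof -
    have one: "(\<lambda>_. 1) \<in> ?V" by (auto simp: bounded_iff)
    then have "P0 (\<lambda>_. 1) \<in> range k" using P0r by blast
    then obtain x where "P0 (\<lambda>_. 1) = Q (j x)" unfolding k_def by (rule imageE)
    with QV[OF jV] have "P0 (\<lambda>_. 1) \<in> ?V" by (simp only:)
    then have "0 \<le> ?n (P0 (\<lambda>_. 1))" by (rule L.nrm_nonneg)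
    also have "\<dots> \<le> b * ?n (\<lambda>_. 1)" by (rule P0n[OF one])
    finally show ?thesis by simp
  qed
  have ka: "k (x + y) = (\<lambda>\<phi>. k x \<phi> + k y \<phi>)" for x y
    by (simp add: k_def ja Qa jV)
  have ks: "k (c *\<^sub>C x) = (\<lambda>\<phi>. c * k x \<phi>)" for c x
    by (simp add: k_def js Qs jV)
  have k_inj: "x = y" if "k x = k y" for x y
  proof -
    have "k ((x - y) + y) = k y" using that by simp
    then have "k (x - y) = (\<lambda>\<phi>. 0)" unfolding ka by (simp add: fun_eq_iff)
    then have "norm (x - y) = 0" using kn[of "x - y"] by simp
    then show ?thesis by simp
  qed
  have "\<forall>v\<in>V. \<exists>x. k x = P0 (Q v)"
  proof
    fix v assume "v \<in> V"
    then have "P0 (Q v) \<in> range k" using P0r QV by blast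
    then show "\<exists>x. k x = P0 (Q v)" by (metis imageE)
  qed
  then obtain R where R: "\<And>v. v \<in> V \<Longrightarrow> k (R v) = P0 (Q v)" by metis
  have Rj: "R (j x) = x" for x
  proof (rule k_inj)
    have "k x \<in> P0 ` ?V" using P0r by blast
    then have "P0 (k x) = k x" using P0i by auto
    then show "k (R (j x)) = k x" using R[OF jV] by (simp add: k_def)
  qed
  have Ra: "R (vadd v w) = R v + R w" if "v \<in> V" "w \<in> V" for v w
    by (rule k_inj) (simp add: R ka Qa that P0a[OF QV QV] add_closed)
  have Rs: "R (vscale c v) = c *\<^sub>C R v" if "v \<in> V" for c v
    by (rule k_inj) (simp add: R ks Qs that P0s[OF QV] scale_closed)
  have Rn: "norm (R v) \<le> b * nrm v" if "v \<in> V" for v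
  proof -
    have "norm (R v) = ?n (P0 (Q v))" using kn[of "R v"] R[OF that] by simp
    also have "\<dots> \<le> b * ?n (Q v)" by (rule P0n[OF QV[OF that]])
    also have "\<dots> \<le> b * nrm v" by (rule mult_left_mono[OF Qn[OF that] b])
    finally show ?thesis .
  qed
  have "projection_on V vadd vscale nrm (range j) b (\<lambda>v. j (R v))"
    unfolding projection_on_def
  proof (intro conjI ballI allI)
    show "(\<lambda>v. j (R v)) ` V = range j" 
    proof (intro subset_antisym subsetI)
      fix u assume "u \<in> range j"
      then obtain x where "u = j x" by auto
      then have "u = j (R (j x))" by (simp add: Rj)
      then show "u \<in> (\<lambda>v. j (R v)) ` V" using jV by blast
    qed auto
  qed (simp_all add: Ra Rs ja js jn Rj Rn)
  then show "\<exists>P. projection_on V vadd vscale nrm (range j) b P" by blast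
qed

end

theory Submission
  imports Defs
begin

text \<open>The second adjoint of \<open>\<iota>\<close> embeds \<open>X\<^sup>*\<^sup>*\<close> isometrically in \<open>Z\<^sup>*\<^sup>*\<close>, so the projection turns the
  canonical embedding of \<open>Z\<close> into \<open>J : Z \<rightarrow> X\<^sup>*\<^sup>*\<close>, of norm at most \<open>\<lambda>\<close>, which extends that of \<open>X\<close>.
  Because \<open>T\<^sup>*\<close> is \<open>p\<close>-compact, \<open>T\<^sup>*\<^sup>*\<close> takes values in \<open>Y\<close>, and \<open>T' = T\<^sup>*\<^sup>* J\<close> extends \<open>T\<close>.
  Its adjoint is \<open>R T\<^sup>*\<close>, where \<open>R : X\<^sup>* \<rightarrow> Z\<^sup>*\<close>, \<open>R \<phi> z = J z \<phi>\<close>, has norm at most \<open>\<lambda>\<close>, so \<open>R\<close>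
  maps every sequence witnessing the \<open>p\<close>-compactness of \<open>T\<^sup>*\<close> to one for \<open>T'\<^sup>*\<close>.\<close>

section \<open>Bounded complex linear operators\<close>

lemma bounded_linear_cblinfun_apply: "bounded_linear (cblinfun_apply f)"
  by transfer (simp add: bounded_clinear_def)

lemmas cblinfun_add = linear_add[OF bounded_linear.linear[OF bounded_linear_cblinfun_apply]]
  and cblinfun_diff = linear_diff[OF bounded_linear.linear[OF bounded_linear_cblinfun_apply]]
  and cblinfun_zero = linear_0[OF bounded_linear.linear[OF bounded_linear_cblinfun_apply]]
  and cblinfun_sum = linear_sum[OF bounded_linear.linear[OF bounded_linear_cblinfun_apply]]

lemma cblinfun_apply_add: "cblinfun_apply (f + g) x = f x + g x"
  by transfer simp

lemma cblinfun_apply_zero: "cblinfun_apply 0 x = 0"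
  by transfer simp

lemma cblinfun_apply_scaleC: "cblinfun_apply (c *\<^sub>C f) x = c *\<^sub>C f x"
  by transfer simp

lemma cblinfun_apply_sum: "cblinfun_apply (sum f A) x = (\<Sum>i\<in>A. f i x)"
  by (induction A rule: infinite_finite_induct)
    (simp_all add: cblinfun_apply_add cblinfun_apply_zero)

lemma norm_cblinfun: "norm (cblinfun_apply f x) \<le> norm f * norm x"
  by transfer (simp add: bounded_clinear_def onorm)

lemma norm_cblinfun_le: "norm f \<le> K \<Longrightarrow> norm x \<le> L \<Longrightarrow> norm (cblinfun_apply f x) \<le> K * L"
  by (meson norm_cblinfun order_trans mult_mono norm_ge_zero)

lemma norm_cblinfun_bound:
  "0 \<le> K \<Longrightarrow> (\<And>x. norm (cblinfun_apply f x) \<le> K * norm x) \<Longrightarrow> norm f \<le> K"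
  by transfer (rule onorm_bound)

text \<open>Turns maps that are given pointwise, such as \<open>J\<close>, \<open>T'\<close> and
  \<open>R\<close> below, into elements of the operator type. Real homogeneity is complex
  homogeneity at real scalars.\<close>

lemma obtain_cblinfun:
  assumes "\<And>x y. f (x + y) = f x + f y"
    and "\<And>c x. f (c *\<^sub>C x) = c *\<^sub>C f x"
    and "\<And>x. norm (f x) \<le> K * norm x" and "0 \<le> K"
  obtains F :: "'a::complex_normed_vector \<Rightarrow>\<^sub>C\<^sub>L 'b::complex_normed_vector"
  where "\<And>x. F x = f x" "norm F \<le> K"
proof -
  have "bounded_clinear f"
    unfolding bounded_clinear_def
    by (auto intro!: bounded_linear_intro[where K = K] simp: assms scaleR_scaleC)
       (metis assms(3) mult.commute)
  then have "\<And>x. CBlinfun f x = f x"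
    by (simp add: CBlinfun_inverse)
  then show thesis
    using that norm_cblinfun_bound assms(3,4) by metis
qed

lemma norm_adj_le: "norm (adj T) \<le> norm T"
proof (rule norm_cblinfun_bound)
  show "norm (adj T \<phi>) \<le> norm T * norm \<phi>" for \<phi>
    using norm_cblinfun_le[OF order_refl[of "norm \<phi>"] norm_cblinfun[of T]]
    by (intro norm_cblinfun_bound) (simp_all add: adj_apply mult_ac)
qed simp

section \<open>Norming functionals and the canonical embedding into the bidual\<close>

lemma obtain_norming_functional:
  fixes x :: "'a::complex_normed_vector"
  obtains \<phi> :: "'a cdual" where "norm \<phi> \<le> 1" "\<phi> x = complex_of_real (norm x)"
proof -
  obtain h :: "'a \<Rightarrow> complex" where h: "\<And>x y. h (x + y) = h x + h y" "\<And>c x. h (c *\<^sub>C x) = c * h x"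
    "\<And>x. cmod (h x) \<le> norm x" "h x = complex_of_real (norm x)"
    by (rule ex_norming_functional[of x]) blast
  obtain \<phi> :: "'a cdual" where "\<And>x. \<phi> x = h x" "norm \<phi> \<le> 1"
    by (rule obtain_cblinfun[of h 1]) (blast | simp add: h scaleC_complex_def)+
  with h(4) that show thesis by metis
qed

lemma norm_le_dual:
  fixes x :: "'a::complex_normed_vector"
  assumes "\<And>\<phi> :: 'a cdual. norm \<phi> \<le> 1 \<Longrightarrow> cmod (cblinfun_apply \<phi> x) \<le> K"
  shows "norm x \<le> K"
proof -
  obtain \<phi> :: "'a cdual" where "norm \<phi> \<le> 1" "\<phi> x = complex_of_real (norm x)"
    by (rule obtain_norming_functional)
  with assms[of \<phi>] show ?thesis by simp
qed

lemma dual_separates: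
  fixes x y :: "'a::complex_normed_vector"
  assumes "\<And>\<phi> :: 'a cdual. cblinfun_apply \<phi> x = cblinfun_apply \<phi> y"
  shows "x = y"
proof -
  have "norm (x - y) \<le> 0"
    by (rule norm_le_dual) (simp add: cblinfun_diff assms)
  then show ?thesis by simp
qed

lift_definition bidual :: "'a::complex_normed_vector \<Rightarrow> 'a cdual cdual"
  is "\<lambda>x \<phi>. cblinfun_apply \<phi> x"
proof -
  fix x :: 'a
  show "bounded_clinear (\<lambda>\<phi> :: 'a cdual. cblinfun_apply \<phi> x)"
    unfolding bounded_clinear_def
    by (auto intro!: bounded_linear_intro[where K = "norm x"] norm_cblinfun
        simp: cblinfun_apply_add cblinfun_apply_scaleC scaleR_scaleC)
qed

lemma bidual_add: "bidual (x + y) = bidual x + bidual y"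
  by (rule cblinfun_eqI) (simp add: bidual.rep_eq cblinfun_apply_add cblinfun_add)

lemma bidual_scaleC: "bidual (c *\<^sub>C x) = c *\<^sub>C bidual x"
  by (rule cblinfun_eqI) (simp add: bidual.rep_eq cblinfun_apply_scaleC cblinfun_scaleC)

lemma norm_bidual_le: "norm (bidual x) \<le> norm x"
  by (rule norm_cblinfun_bound) (simp_all add: bidual.rep_eq norm_cblinfun mult.commute[of "norm x"])

section \<open>Norm-preserving extension of functionals and the map from Z to the bidual of
  X\<close>

text \<open>\<open>hahn_banach_complex\<close> extends functionals dominated by the norm itself, so
  \<phi> is divided by its norm, extended from the range of \<iota>, and scaled back. The case
  \<phi> = 0 is split off for this division.\<close>

lemma functional_extension:
  fixes \<iota> :: "'x::complex_normed_vector \<Rightarrow>\<^sub>C\<^sub>L 'z::complex_normed_vector" and \<phi> :: "'x cdual"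
  assumes iso: "\<And>x. norm (\<iota> x) = norm x"
  obtains \<xi> :: "'z cdual" where "adj \<iota> \<xi> = \<phi>" "norm \<xi> \<le> norm \<phi>"
proof (cases "\<phi> = 0")
  case True
  with that[of 0] show thesis
    by (simp add: cblinfun_zero)
next
  case False
  then have n: "norm \<phi> > 0" by simp
  interpret complex_normed_on "UNIV :: 'z set" "(+)" 0 "(*\<^sub>C)" norm
    by (rule complex_normed_on_UNIV)
  define H where "H = {(\<iota> x, \<phi> x / norm \<phi>) |x. True}"
  obtain h where hH: "\<And>x r. (x, r) \<in> H \<Longrightarrow> h x = r"
    and ha: "\<And>x y. x \<in> UNIV \<Longrightarrow> y \<in> UNIV \<Longrightarrow> h (x + y) = h x + h y"
    and hs: "\<And>x c. x \<in> UNIV \<Longrightarrow> h (c *\<^sub>C x) = c * h x"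
    and hn: "\<And>x. x \<in> UNIV \<Longrightarrow> cmod (h x) \<le> norm x"
  proof (rule hahn_banach_complex[of H])
    fix x y r s c
    show "x \<in> UNIV \<and> cmod r \<le> norm x" if "(x, r) \<in> H"
      using that n norm_cblinfun[of \<phi>]
      by (auto simp: H_def iso norm_divide divide_le_eq mult.commute[of _ "norm \<phi>"])
    show "(x + y, r + s) \<in> H" if H: "(x, r) \<in> H" "(y, s) \<in> H"
    proof -
      obtain x' y' where "x = \<iota> x'" "r = \<phi> x' / norm \<phi>" "y = \<iota> y'" "s = \<phi> y' / norm \<phi>"
        using H by (auto simp: H_def)
      then have "(x + y, r + s) = (\<iota> (x' + y'), \<phi> (x' + y') / norm \<phi>)"
        by (simp add: cblinfun_add add_divide_distrib)
      then show ?thesis unfolding H_def by blast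
    qed
    show "(c *\<^sub>C x, c * r) \<in> H" if H: "(x, r) \<in> H"
    proof -
      obtain x' where "x = \<iota> x'" "r = \<phi> x' / norm \<phi>"
        using H by (auto simp: H_def)
      then have "(c *\<^sub>C x, c * r) = (\<iota> (c *\<^sub>C x'), \<phi> (c *\<^sub>C x') / norm \<phi>)"
        by (simp add: cblinfun_scaleC scaleC_complex_def)
      then show ?thesis unfolding H_def by blast
    qed
    show "H \<noteq> {}" by (auto simp: H_def)
  qed blast
  obtain \<xi> :: "'z cdual" where \<xi>: "\<And>z. \<xi> z = complex_of_real (norm \<phi>) * h z" "norm \<xi> \<le> norm \<phi>"
    by (rule obtain_cblinfun[of "\<lambda>z. complex_of_real (norm \<phi>) * h z" "norm \<phi>"])
      (blast | simp add: ha hs hn scaleC_complex_def norm_mult mult_left_mono distrib_left)+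
  have "h (\<iota> x) = \<phi> x / norm \<phi>" for x
    by (rule hH) (auto simp: H_def)
  then have "adj \<iota> \<xi> = \<phi>"
    using n by (intro cblinfun_eqI) (simp add: adj_apply \<xi>)
  with \<xi>(2) that show thesis by blast
qed

text \<open>The upper bound holds because taking adjoints does not increase the norm of the
  contraction \<iota>. For the lower bound, every \<phi> lifts to some \<xi> of no larger norm, so
  the second adjoint of \<iota> at \<psi> still sees every value of \<psi>.\<close>

lemma norm_adj_adj:
  fixes \<iota> :: "'x::complex_normed_vector \<Rightarrow>\<^sub>C\<^sub>L 'z::complex_normed_vector"
  assumes iso: "\<And>x. norm (cblinfun_apply \<iota> x) = norm x"
  shows "norm (adj (adj \<iota>) \<psi>) = norm \<psi>"
proof (rule antisym)
  have "norm \<iota> \<le> 1"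
    by (rule norm_cblinfun_bound) (simp_all add: iso)
  then have "norm (adj (adj \<iota>)) \<le> 1"
    using norm_adj_le[of \<iota>] norm_adj_le[of "adj \<iota>"] by linarith
  from norm_cblinfun_le[OF this order_refl] show "norm (adj (adj \<iota>) \<psi>) \<le> norm \<psi>"
    by simp
  show "norm \<psi> \<le> norm (adj (adj \<iota>) \<psi>)"
  proof (rule norm_cblinfun_bound)
    fix \<phi>
    obtain \<xi> where \<xi>: "adj \<iota> \<xi> = \<phi>" "norm \<xi> \<le> norm \<phi>"
      using functional_extension[OF iso] by blast
    have "\<psi> \<phi> = adj (adj \<iota>) \<psi> \<xi>"
      by (simp add: adj_apply \<xi>)
    also have "norm \<dots> \<le> norm (adj (adj \<iota>) \<psi>) * norm \<phi>"
      by (rule norm_cblinfun_le[OF order_refl \<xi>(2)])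
    finally show "norm (\<psi> \<phi>) \<le> norm (adj (adj \<iota>) \<psi>) * norm \<phi>" .
  qed simp
qed

text \<open>Lets a Banach space given as a type, here the bidual of Z, serve as the superspace in
  \<open>P_space_in\<close>.\<close>

lemma complex_banach_on_UNIV:
  "complex_banach_on (UNIV :: 'e::complex_banach set) (+) 0 (*\<^sub>C) norm"
proof -
  interpret complex_normed_on "UNIV :: 'e set" "(+)" 0 "(*\<^sub>C)" norm
    by (rule complex_normed_on_UNIV)
  have m: "x + (- 1) *\<^sub>C y = x - y" for x y :: 'e
    using scaleR_scaleC[of "-1" y] by simp
  show ?thesis
  proof
    fix s :: "nat \<Rightarrow> 'e"
    assume "\<And>e. e > 0 \<Longrightarrow> \<exists>N. \<forall>m\<ge>N. \<forall>n\<ge>N. norm (s m + (- 1) *\<^sub>C s n) < e"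
    then have "Cauchy s"
      by (simp add: Cauchy_def dist_norm m)
    then obtain l where "s \<longlonglongrightarrow> l"
      using Cauchy_convergent_iff convergent_def by blast
    then have "(\<lambda>n. norm (s n - l)) \<longlonglongrightarrow> 0"
      using tendsto_norm_zero LIM_zero by blast
    then show "\<exists>x\<in>UNIV. (\<lambda>n. norm (s n + (- 1) *\<^sub>C x)) \<longlonglongrightarrow> 0"
      by (auto simp: m)
  qed
qed

lemma bidual_extension:
  fixes \<iota> :: "'x::complex_banach \<Rightarrow>\<^sub>C\<^sub>L 'z::complex_banach"
  assumes iso: "\<And>x. norm (\<iota> x) = norm x"
    and P: "P_space TYPE('x cdual cdual) lam" and lam: "0 \<le> lam"
  obtains J :: "'z \<Rightarrow>\<^sub>C\<^sub>L 'x cdual cdual" where "\<And>x. J (\<iota> x) = bidual x" "norm J \<le> lam"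
proof -
  define j where "j = cblinfun_apply (adj (adj \<iota>))"
  have jn: "norm (j \<psi>) = norm \<psi>" for \<psi>
    unfolding j_def by (rule norm_adj_adj[OF iso])
  have ja: "j (x + y) = j x + j y" and jd: "j (x - y) = j x - j y"
    and js: "j (c *\<^sub>C x) = c *\<^sub>C j x" for c x y
    by (simp_all add: j_def cblinfun_add cblinfun_scaleC cblinfun_diff)
  have j_inj: "x = y" if "j x = j y" for x y
    using jn[of "x - y"] that by (simp add: jd)
  have "isometric_embedding_on UNIV (+) (*\<^sub>C) norm j"
    by (simp add: isometric_embedding_on_def ja js jn)
  \<comment> \<open>\<open>P_space\<close> speaks of superspaces on one fixed type; the projection
    is wanted on the bidual of Z.\<close>
  moreover have "P_space_in TYPE('z cdual cdual) TYPE('x cdual cdual) lam"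
    by (rule P_space_imp_P_space_in[OF P])
  ultimately obtain Q where Q: "projection_on (UNIV :: 'z cdual cdual set) (+) (*\<^sub>C) norm (range j) lam Q"
    unfolding P_space_in_def using complex_banach_on_UNIV by metis
  have Qa: "Q (x + y) = Q x + Q y" and Qs: "Q (c *\<^sub>C x) = c *\<^sub>C Q x" and Qi: "Q (Q x) = Q x"
    and Qn: "norm (Q x) \<le> lam * norm x" and Qr: "range Q = range j" for x y c
    using Q by (auto simp: projection_on_def)
  \<comment> \<open>\<open>K\<close> is the projected canonical embedding pulled back along
    \<open>j\<close>; its linearity follows from injectivity of \<open>j\<close>.\<close>
  have "\<exists>\<psi>. j \<psi> = Q (bidual z)" for z
    using Qr by (metis rangeE rangeI)
  then obtain K where K: "\<And>z. j (K z) = Q (bidual z)" by metis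
  have "norm (K z) \<le> lam * norm z" for z
  proof -
    have "norm (K z) = norm (Q (bidual z))"
      using jn K by metis
    also have "\<dots> \<le> lam * norm (bidual z)"
      by (rule Qn)
    also have "\<dots> \<le> lam * norm z"
      by (rule mult_left_mono[OF norm_bidual_le lam])
    finally show ?thesis .
  qed
  moreover have "K (x + y) = K x + K y" for x y
    by (rule j_inj) (simp add: ja K bidual_add Qa)
  moreover have "K (c *\<^sub>C x) = c *\<^sub>C K x" for c x
    by (rule j_inj) (simp add: js K bidual_scaleC Qs)
  ultimately obtain J :: "'z \<Rightarrow>\<^sub>C\<^sub>L 'x cdual cdual" where J: "\<And>z. J z = K z" "norm J \<le> lam"
    using obtain_cblinfun[of K lam] lam by blast
  have "K (\<iota> x) = bidual x" for x
  proof (rule j_inj)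
    \<comment> \<open>Naturality of the canonical embedding places \<open>bidual (\<iota> x)\<close>
      in the range of \<open>j\<close>, where \<open>Q\<close> acts as the identity.\<close>
    have bj: "bidual (\<iota> x) = j (bidual x)"
      by (rule cblinfun_eqI) (simp add: j_def adj_apply bidual.rep_eq)
    obtain u where "Q u = bidual (\<iota> x)"
      using Qr bj by (metis rangeE rangeI)
    then show "j (K (\<iota> x)) = j (bidual x)"
      using Qi K bj by metis
  qed
  with J that show thesis by metis
qed


section \<open>Uniform tails against the unit ball of \<open>\<ell>\<^sub>q\<close>\<close>

lemma conj_exponent_gt_1: "1 < p \<Longrightarrow> 1 < conj_exponent p"
  by (simp add: conj_exponent_def field_simps)

lemma lp_ball_sum_le:
  assumes "\<alpha> \<in> lp_ball q" "1 < q" "finite F"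
  shows "(\<Sum>n\<in>F. cmod (\<alpha> n) powr q) \<le> 1"
proof -
  let ?s = "\<Sum>n. cmod (\<alpha> n) powr q"
  have s: "summable (\<lambda>n. cmod (\<alpha> n) powr q)" and "?s powr (1 / q) \<le> 1"
    using assms by (auto simp: lp_ball_def lp_space_def lp_norm_def)
  have "?s \<ge> 0" using s by (simp add: suminf_nonneg)
  have "?s \<le> 1"
  proof (rule ccontr)
    assume "\<not> ?s \<le> 1"
    then have "1 < ?s powr (1 / q)"
      using assms(2) by (intro gr_one_powr) auto
    with \<open>?s powr (1 / q) \<le> 1\<close> show False by simp
  qed
  moreover have "(\<Sum>n\<in>F. cmod (\<alpha> n) powr q) \<le> ?s"
    using s assms(3) by (intro sum_le_suminf) auto
  ultimately show ?thesis by simp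
qed

lemma unit_in_lp_ball: "0 < q \<Longrightarrow> (\<lambda>n. if n = k then 1 else 0) \<in> lp_ball q"
proof -
  assume q: "0 < q"
  have "(\<lambda>n. cmod (if n = k then 1 else 0) powr q) sums 1"
    using sums_single[of k "\<lambda>_. 1 :: real"] q
    by (simp add: if_distrib[of cmod] if_distribR if_distrib[of "\<lambda>x. x powr q"] cong: if_cong)
  then show ?thesis
    by (simp add: lp_ball_def lp_space_def lp_norm_def sums_iff)
qed

text \<open>The weight \<open>d\<close> splits the product into \<open>b n / d\<close> and
  \<open>d * cmod (\<alpha> n)\<close> before Young's inequality is applied. The q-th powers of
  \<alpha> sum to at most 1, so their part is at most \<open>d\<close>; for fixed \<open>d\<close>
  the rest is small as soon as the p-sum of \<open>b\<close> is.\<close>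

lemma lp_ball_young:
  assumes p: "1 < p" and \<alpha>: "\<alpha> \<in> lp_ball (conj_exponent p)" and b: "\<And>n. 0 \<le> b n"
    and d: "0 < d" "d \<le> 1" and F: "finite F"
  shows "(\<Sum>n\<in>F. cmod (\<alpha> n) * b n) \<le> d + (\<Sum>n\<in>F. b n powr p) / d powr p"
proof -
  let ?q = "conj_exponent p"
  have q: "1 < ?q" by (rule conj_exponent_gt_1[OF p])
  have "cmod (\<alpha> n) * b n \<le> d * cmod (\<alpha> n) powr ?q + b n powr p / d powr p" for n
  proof -
    have "cmod (\<alpha> n) * b n = (b n / d) * (d * cmod (\<alpha> n))"
      using d by simp
    also have "\<dots> \<le> (b n / d) powr p / p + (d * cmod (\<alpha> n)) powr ?q / ?q"
      using conj_exponent[OF p] p q b d by (intro Youngs_inequality) auto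
    also have "(b n / d) powr p / p \<le> (b n / d) powr p"
      using p by (simp add: divide_le_eq mult_le_cancel_left1 powr_ge_zero)
    also have "(b n / d) powr p = b n powr p / d powr p"
      using b d by (simp add: powr_divide)
    also have "(d * cmod (\<alpha> n)) powr ?q / ?q \<le> (d * cmod (\<alpha> n)) powr ?q"
      using q by (simp add: divide_le_eq mult_le_cancel_left1 powr_ge_zero)
    also have "\<dots> = d powr ?q * cmod (\<alpha> n) powr ?q"
      using d by (simp add: powr_mult)
    \<comment> \<open>Here \<open>d \<le> 1\<close> enters: its q-th power is at most
      \<open>d\<close>.\<close>
    also have "\<dots> \<le> d * cmod (\<alpha> n) powr ?q"
      using powr_mono'[of 1 ?q d] q d by (intro mult_right_mono) auto
    finally show ?thesis by simp
  qed
  then have "(\<Sum>n\<in>F. cmod (\<alpha> n) * b n)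
      \<le> (\<Sum>n\<in>F. d * cmod (\<alpha> n) powr ?q + b n powr p / d powr p)"
    by (intro sum_mono)
  also have "\<dots> = d * (\<Sum>n\<in>F. cmod (\<alpha> n) powr ?q) + (\<Sum>n\<in>F. b n powr p) / d powr p"
    by (simp add: sum.distrib sum_distrib_left sum_divide_distrib)
  also have "d * (\<Sum>n\<in>F. cmod (\<alpha> n) powr ?q) \<le> d"
    using lp_ball_sum_le[OF \<alpha> q F] d by (simp add: mult_le_cancel_left1)
  finally show ?thesis by simp
qed

lemma lp_ball_tail:
  assumes p: "1 < p" and b: "\<And>n. 0 \<le> b n" and s: "summable (\<lambda>n. b n powr p)" and e: "0 < e"
  obtains M where "\<And>\<alpha> m. \<alpha> \<in> lp_ball (conj_exponent p) \<Longrightarrow>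
    (\<Sum>n\<in>{M..<m}. cmod (\<alpha> n) * b n) \<le> e"
proof -
  \<comment> \<open>\<open>d\<close> accounts for half of \<open>e\<close>. With \<open>d\<close>
    fixed, \<open>M\<close> makes the p-tail of \<open>b\<close> so small that it stays below the
    other half after division by \<open>d powr p\<close>. Neither choice depends on
    \<alpha>.\<close>
  define d where "d = min 1 (e / 2)"
  have d: "0 < d" "d \<le> 1" "d \<le> e / 2" using e by (auto simp: d_def)
  have "0 < d powr p * (e / 2)" using d e by simp
  from suminf_exist_split[OF this s] obtain M
    where "norm (\<Sum>i. b (i + M) powr p) < d powr p * (e / 2)" by blast
  then have M: "(\<Sum>i. b (i + M) powr p) \<le> d powr p * (e / 2)" by simp
  show thesis
  proof (rule that[of M])
    fix \<alpha> m assume \<alpha>: "\<alpha> \<in> lp_ball (conj_exponent p)"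
    have "(\<Sum>n\<in>{M..<m}. b n powr p) = (\<Sum>i<m - M. b (i + M) powr p)"
      by (rule sum.reindex_bij_witness[of _ "\<lambda>i. i + M" "\<lambda>n. n - M"]) auto
    also have "\<dots> \<le> (\<Sum>i. b (i + M) powr p)"
      using s by (intro sum_le_suminf) (auto intro: summable_ignore_initial_segment)
    also have "\<dots> \<le> d powr p * (e / 2)" by (rule M)
    finally have "(\<Sum>n\<in>{M..<m}. b n powr p) / d powr p \<le> e / 2"
      using d by (simp add: divide_le_eq mult.commute)
    moreover have "(\<Sum>n\<in>{M..<m}. cmod (\<alpha> n) * b n)
        \<le> d + (\<Sum>n\<in>{M..<m}. b n powr p) / d powr p"
      by (rule lp_ball_young[OF p \<alpha> b d(1,2)]) simp
    ultimately show "(\<Sum>n\<in>{M..<m}. cmod (\<alpha> n) * b n) \<le> e"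
      using d(3) by linarith
  qed
qed

section \<open>Convergence of \<open>E_op\<close> and its behaviour under bounded operators\<close>

lemma lp_ball_bounded:
  assumes p: "1 < p" and b: "\<And>n. 0 \<le> b n" and s: "summable (\<lambda>n. b n powr p)"
    and \<alpha>: "\<alpha> \<in> lp_ball (conj_exponent p)"
  shows "(\<Sum>n<m. cmod (\<alpha> n) * b n) \<le> 1 + (\<Sum>n. b n powr p)"
proof -
  have "(\<Sum>n<m. cmod (\<alpha> n) * b n) \<le> 1 + (\<Sum>n<m. b n powr p)"
    using lp_ball_young[OF p \<alpha> b, of 1 "{..<m}"] by simp
  also have "(\<Sum>n<m. b n powr p) \<le> (\<Sum>n. b n powr p)"
    using s by (intro sum_le_suminf) auto
  finally show ?thesis by simp
qed

lemma summable_E_op: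
  fixes a :: "nat \<Rightarrow> 'a::complex_banach"
  assumes p: "1 < p" and a: "a \<in> lp_space p" and \<alpha>: "\<alpha> \<in> lp_ball (conj_exponent p)"
  shows "summable (\<lambda>n. \<alpha> n *\<^sub>C a n)"
proof (rule summable_norm_cancel, rule bounded_imp_summable)
  show "(\<Sum>k\<le>n. norm (\<alpha> k *\<^sub>C a k)) \<le> 1 + (\<Sum>n. norm (a n) powr p)" for n
    using lp_ball_bounded[OF p, of "\<lambda>n. norm (a n)" \<alpha> "Suc n"] a \<alpha>
    by (simp add: norm_scaleC lp_space_def lessThan_Suc_atMost)
qed simp

text \<open>Norm convergence lets a bounded operator pass through the series, so the coefficients
  that represent a point by \<open>a\<close> represent its image by the image sequence.\<close>

lemma cblinfun_E_op:
  fixes R :: "'a::complex_banach \<Rightarrow>\<^sub>C\<^sub>L 'b::complex_banach"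
  assumes "1 < p" "a \<in> lp_space p" "\<alpha> \<in> lp_ball (conj_exponent p)"
  shows "cblinfun_apply R (E_op a \<alpha>) = E_op (\<lambda>n. R (a n)) \<alpha>"
  unfolding E_op_def
  using bounded_linear.suminf[OF bounded_linear_cblinfun_apply summable_E_op[OF assms]]
  by (simp add: cblinfun_scaleC)

lemma lp_space_cblinfun:
  fixes R :: "'a::complex_banach \<Rightarrow>\<^sub>C\<^sub>L 'b::complex_banach"
  assumes p: "0 < p" and a: "a \<in> lp_space p"
  shows "(\<lambda>n. cblinfun_apply R (a n)) \<in> lp_space p"
    and "lp_norm p (\<lambda>n. cblinfun_apply R (a n)) \<le> norm R * lp_norm p a"
proof -
  have s: "summable (\<lambda>n. norm (a n) powr p)"
    using a by (simp add: lp_space_def)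
  have le: "norm (R (a n)) powr p \<le> norm R powr p * norm (a n) powr p" for n
    using powr_mono2[OF less_imp_le[OF p] norm_ge_zero norm_cblinfun[of R "a n"]]
    by (simp add: powr_mult)
  have s': "summable (\<lambda>n. norm (R (a n)) powr p)"
    by (rule summable_comparison_test'[OF summable_mult[OF s, of "norm R powr p"]]) (simp add: le)
  then show "(\<lambda>n. R (a n)) \<in> lp_space p"
    by (simp add: lp_space_def)
  have "(\<Sum>n. norm (R (a n)) powr p) \<le> norm R powr p * (\<Sum>n. norm (a n) powr p)"
    using suminf_le[OF le s' summable_mult[OF s]] by (simp add: suminf_mult[OF s])
  then have "lp_norm p (\<lambda>n. R (a n)) \<le> (norm R powr p * (\<Sum>n. norm (a n) powr p)) powr (1 / p)"
    unfolding lp_norm_def using p s' by (intro powr_mono2) (auto intro: suminf_nonneg)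
  also have "\<dots> = norm R * lp_norm p a"
    using p s by (simp add: powr_mult powr_powr suminf_nonneg lp_norm_def)
  finally show "lp_norm p (\<lambda>n. R (a n)) \<le> norm R * lp_norm p a" .
qed


section \<open>The bidual operator takes values in the space itself\<close>

text \<open>No bound on the norm of \<open>x\<close> is needed here, so Hahn--Banach in a sequence space replaces
  Goldstine's theorem. A functional \<open>h\<close> that annihilates the sequences \<open>(a\<^sub>n(x))\<^sub>n\<close> satisfies
  \<open>\<Sum> h(e\<^sub>n) a\<^sub>n = 0\<close> in the norm of the dual space, because the tails of \<open>(a\<^sub>n(x))\<^sub>n\<close> are small
  uniformly on the unit ball; applying \<open>\<psi>\<close> shows that \<open>h\<close> also annihilates \<open>(\<psi>(a\<^sub>n))\<^sub>n\<close>.\<close>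

lemma bidual_approximation:
  fixes a :: "nat \<Rightarrow> 'x::complex_banach cdual" and \<psi> :: "'x cdual cdual"
  assumes p: "1 < p" and a: "a \<in> lp_space p" and e: "0 < e"
  shows "\<exists>x. \<forall>\<alpha>\<in>lp_ball (conj_exponent p). \<forall>m.
    (\<Sum>n<m. cmod (\<alpha> n) * cmod (\<psi> (a n) - a n x)) \<le> e"
proof (rule ccontr)
  assume neg: "\<not> ?thesis"
  let ?B = "lp_ball (conj_exponent p)"
  \<comment> \<open>Both kinds of sequences to be compared lie in \<open>V\<close>: \<psi> at
    \<open>a n\<close> with constant \<open>norm \<psi>\<close>, and \<open>a n x\<close> with
    constant \<open>norm x\<close>. Domination by \<open>norm (a n)\<close> gives finiteness of
    \<open>N\<close> and uniform tails.\<close>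
  define V where "V = {v :: nat \<Rightarrow> complex. \<exists>C. \<forall>n. cmod (v n) \<le> C * norm (a n)}"
  \<comment> \<open>By duality this is the p-norm of \<open>v\<close>; written as a supremum it
    matches the negated claim directly.\<close>
  define N where "N v = (SUP (\<alpha>, m)\<in>?B \<times> UNIV. \<Sum>n<m. cmod (\<alpha> n) * cmod (v n))"
    for v :: "nat \<Rightarrow> complex"
  have s: "summable (\<lambda>n. norm (a n) powr p)"
    using a by (simp add: lp_space_def)
  have unit: "(\<lambda>n. if n = k then 1 else 0) \<in> ?B" for k
    using conj_exponent_gt_1[OF p] by (intro unit_in_lp_ball) simp
  have VI: "v \<in> V" if "\<And>n. cmod (v n) \<le> C * norm (a n)" for v C
    using that by (auto simp: V_def)
  have VC: "\<exists>C\<ge>0. \<forall>n. cmod (v n) \<le> C * norm (a n)" if v: "v \<in> V" for v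
  proof -
    obtain C where C: "\<And>n. cmod (v n) \<le> C * norm (a n)" using v by (auto simp: V_def)
    have "cmod (v n) \<le> \<bar>C\<bar> * norm (a n)" for n
      by (rule order_trans[OF C]) (simp add: mult_right_mono)
    then show ?thesis by (intro exI[of _ "\<bar>C\<bar>"]) simp
  qed
  have le_C: "(\<Sum>n\<in>F. cmod (\<alpha> n) * cmod (v n)) \<le> C * (\<Sum>n\<in>F. cmod (\<alpha> n) * norm (a n))"
    if "\<And>n. cmod (v n) \<le> C * norm (a n)" for \<alpha> v C F
    unfolding sum_distrib_left
    by (intro sum_mono) (simp add: mult.left_commute[of C] that mult_left_mono)
  have bdd: "bdd_above ((\<lambda>(\<alpha>, m). \<Sum>n<m. cmod (\<alpha> n) * cmod (v n)) ` (?B \<times> UNIV))"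
    if v: "v \<in> V" for v
  proof -
    obtain C where C: "0 \<le> C" "\<And>n. cmod (v n) \<le> C * norm (a n)" using VC[OF v] by blast
    have "(\<Sum>n<m. cmod (\<alpha> n) * cmod (v n)) \<le> C * (1 + (\<Sum>n. norm (a n) powr p))"
      if "\<alpha> \<in> ?B" for \<alpha> m
      using le_C[of v C, OF C(2)] mult_left_mono[OF lp_ball_bounded[OF p norm_ge_zero s that] C(1)]
      by (rule order_trans)
    then show ?thesis by (intro bdd_aboveI) auto
  qed
  have up: "(\<Sum>n<m. cmod (\<alpha> n) * cmod (v n)) \<le> N v" if "v \<in> V" "\<alpha> \<in> ?B" for v \<alpha> m
    unfolding N_def using cSUP_upper[OF _ bdd[OF that(1)], of "(\<alpha>, m)"] that(2) by simp
  have least: "N v \<le> K"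
    if "\<And>\<alpha> m. \<alpha> \<in> ?B \<Longrightarrow> (\<Sum>n<m. cmod (\<alpha> n) * cmod (v n)) \<le> K" for v K
    unfolding N_def using unit by (intro cSUP_least) (auto intro: that)
  \<comment> \<open>Tested on the k-th unit vector, with upper limit \<open>Suc k\<close> so that
    index \<open>k\<close> is included. Definiteness of \<open>N\<close> comes from here.\<close>
  have coord: "cmod (v k) \<le> N v" if "v \<in> V" for v k
    using up[OF that unit[of k], of "Suc k"] by (simp add: sum.delta if_distrib cong: if_cong)
  have addV: "(\<lambda>n. v n + w n) \<in> V" if vw: "v \<in> V" "w \<in> V" for v w
  proof -
    obtain C D where "\<And>n. cmod (v n) \<le> C * norm (a n)" "\<And>n. cmod (w n) \<le> D * norm (a n)"
      using vw by (auto simp: V_def)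
    then show ?thesis
      by (intro VI[of _ "C + D"]) (simp add: distrib_right add_mono norm_triangle_le)
  qed
  have sclV: "(\<lambda>n. c * v n) \<in> V" if v: "v \<in> V" for c v
  proof -
    obtain C where "\<And>n. cmod (v n) \<le> C * norm (a n)" using v by (auto simp: V_def)
    then show ?thesis
      by (intro VI[of _ "cmod c * C"]) (simp add: norm_mult mult.assoc mult_left_mono)
  qed
  have scl_le: "N (\<lambda>n. c * v n) \<le> cmod c * N v" if v: "v \<in> V" for c v
  proof (rule least)
    fix \<alpha> m assume \<alpha>: "\<alpha> \<in> ?B"
    have "(\<Sum>n<m. cmod (\<alpha> n) * cmod (c * v n)) = cmod c * (\<Sum>n<m. cmod (\<alpha> n) * cmod (v n))"
      by (simp add: sum_distrib_left norm_mult mult_ac)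
    also have "\<dots> \<le> cmod c * N v"
      by (intro mult_left_mono up v \<alpha>) simp
    finally show "(\<Sum>n<m. cmod (\<alpha> n) * cmod (c * v n)) \<le> cmod c * N v" .
  qed
  interpret complex_normed_on V "\<lambda>v w n. v n + w n" "\<lambda>n. 0" "\<lambda>c v n. c * v n" N
  proof
    show "(\<lambda>n. 0) \<in> V" by (rule VI[of _ 0]) simp
  next
    fix v w assume v: "v \<in> V" and w: "w \<in> V"
    show "(\<lambda>n. v n + w n) \<in> V" by (rule addV[OF v w])
    show "N (\<lambda>n. v n + w n) \<le> N v + N w"
    proof (rule least)
      fix \<alpha> m assume \<alpha>: "\<alpha> \<in> ?B"
      have "(\<Sum>n<m. cmod (\<alpha> n) * cmod (v n + w n))
          \<le> (\<Sum>n<m. cmod (\<alpha> n) * cmod (v n) + cmod (\<alpha> n) * cmod (w n))"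
        unfolding distrib_left[symmetric] by (intro sum_mono mult_left_mono norm_triangle_ineq) simp
      also have "\<dots> \<le> N v + N w"
        unfolding sum.distrib by (intro add_mono up v w \<alpha>)
      finally show "(\<Sum>n<m. cmod (\<alpha> n) * cmod (v n + w n)) \<le> N v + N w" .
    qed
  next
    fix v c assume v: "v \<in> V"
    show "(\<lambda>n. c * v n) \<in> V" by (rule sclV[OF v])
    show "N v = 0 \<longleftrightarrow> v = (\<lambda>n. 0)"
    proof
      assume "N v = 0"
      then show "v = (\<lambda>n. 0)" using coord[OF v] by auto
    next
      assume "v = (\<lambda>n. 0)"
      then have "N v \<le> 0" by (intro least) simp
      moreover have "0 \<le> N v" using order_trans[OF norm_ge_zero coord[OF v]] .
      ultimately show "N v = 0" by simp
    qed
    show "N (\<lambda>n. c * v n) = cmod c * N v"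
    proof (cases "c = 0")
      case True
      have "N (\<lambda>n. 0) \<le> 0" by (rule least) simp
      moreover have "0 \<le> N (\<lambda>n. 0)"
        using order_trans[OF norm_ge_zero coord] VI[of "\<lambda>n. 0" 0] by fastforce
      ultimately show ?thesis using True by simp
    next
      case False
      have "N (\<lambda>n. inverse c * (c * v n)) \<le> cmod (inverse c) * N (\<lambda>n. c * v n)"
        by (rule scl_le[OF sclV[OF v]])
      then have "N v \<le> cmod (inverse c) * N (\<lambda>n. c * v n)"
        using False by (simp add: mult.assoc[symmetric])
      then have "cmod c * N v \<le> N (\<lambda>n. c * v n)"
        using False by (simp add: norm_inverse norm_divide field_simps)
      with scl_le[OF v, of c] show ?thesis by simp
    qed
  qed (auto simp: algebra_simps)
  define A where "A x = (\<lambda>n. a n x)" for x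
  define w where "w = (\<lambda>n. \<psi> (a n))"
  have AV: "A x \<in> V" for x
    by (rule VI[of _ "norm x"]) (simp add: A_def norm_cblinfun mult.commute[of "norm x"])
  have wV: "w \<in> V"
    by (rule VI[of _ "norm \<psi>"]) (simp add: w_def norm_cblinfun)
  \<comment> \<open>The negated claim keeps \<open>w\<close> at distance at least \<open>e\<close>
    from every \<open>A y\<close>; using it at \<open>- x\<close> turns the difference into a
    sum.\<close>
  have dist: "e \<le> N (\<lambda>n. w n + A x n)" for x
  proof -
    obtain \<alpha> m where "\<alpha> \<in> ?B" "e < (\<Sum>n<m. cmod (\<alpha> n) * cmod (\<psi> (a n) - a n (- x)))"
      using neg by (meson not_le)
    moreover have "\<psi> (a n) - a n (- x) = w n + A x n" for n
      using cblinfun_diff[of "a n" 0 x] by (simp add: w_def A_def cblinfun_zero)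
    ultimately show ?thesis
      using up[OF addV[OF wV AV], of \<alpha> x m] by simp
  qed
  have Aa: "A (x + y) = (\<lambda>n. A x n + A y n)" and As: "A (c *\<^sub>C x) = (\<lambda>n. c * A x n)" for x y c
    by (simp_all add: A_def cblinfun_add cblinfun_scaleC scaleC_complex_def)
  \<comment> \<open>Graph of the functional on the span of \<open>w\<close> and the range of
    \<open>A\<close> that kills the range and sends \<open>w\<close> to \<open>e\<close>;
    \<open>dist\<close> is what makes it dominated by \<open>N\<close>.\<close>
  define H where "H = {(\<lambda>n. c * w n + A x n, c * e) |c x. True}"
  obtain h where hH: "\<And>v r. (v, r) \<in> H \<Longrightarrow> h v = r"
    and ha: "\<And>v u. v \<in> V \<Longrightarrow> u \<in> V \<Longrightarrow> h (\<lambda>n. v n + u n) = h v + h u"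
    and hs: "\<And>v c. v \<in> V \<Longrightarrow> h (\<lambda>n. c * v n) = c * h v"
    and hn: "\<And>v. v \<in> V \<Longrightarrow> cmod (h v) \<le> N v"
  proof (rule hahn_banach_complex[of H])
    fix v u r s d
    show "v \<in> V \<and> cmod r \<le> N v" if vr: "(v, r) \<in> H"
    proof -
      obtain c x where v: "v = (\<lambda>n. c * w n + A x n)" and r: "r = c * e"
        using vr by (auto simp: H_def)
      have vV: "v \<in> V" unfolding v by (intro addV sclV wV AV)
      moreover have "cmod r \<le> N v"
      proof (cases "c = 0")
        case True
        then show ?thesis using nrm_nonneg[OF vV] by (simp add: r)
      next
        case False
        have "v = (\<lambda>n. c * (w n + A (inverse c *\<^sub>C x) n))"
          using False by (simp add: v As distrib_left mult.assoc[symmetric])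
        then have "N v = cmod c * N (\<lambda>n. w n + A (inverse c *\<^sub>C x) n)"
          using nrm_scale[OF addV[OF wV AV]] by simp
        then show ?thesis
          using dist e by (simp add: r norm_mult mult_left_mono)
      qed
      ultimately show ?thesis by blast
    qed
    show "(\<lambda>n. v n + u n, r + s) \<in> H" if vu: "(v, r) \<in> H" "(u, s) \<in> H"
    proof -
      obtain c x c' x' where "v = (\<lambda>n. c * w n + A x n)" "r = c * e"
        "u = (\<lambda>n. c' * w n + A x' n)" "s = c' * e"
        using vu by (auto simp: H_def)
      then have "(\<lambda>n. v n + u n, r + s) = (\<lambda>n. (c + c') * w n + A (x + x') n, (c + c') * e)"
        by (simp add: Aa algebra_simps)
      then show ?thesis unfolding H_def by blast
    qed
    show "(\<lambda>n. d * v n, d * r) \<in> H" if vr: "(v, r) \<in> H"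
    proof -
      obtain c x where "v = (\<lambda>n. c * w n + A x n)" "r = c * e"
        using vr by (auto simp: H_def)
      then have "(\<lambda>n. d * v n, d * r) = (\<lambda>n. (d * c) * w n + A (d *\<^sub>C x) n, (d * c) * e)"
        by (simp add: As algebra_simps)
      then show ?thesis unfolding H_def by blast
    qed
    show "H \<noteq> {}" by (auto simp: H_def)
  qed blast
  have hA: "h (A x) = 0" for x
  proof -
    have "(\<lambda>n. 0 * w n + A x n, 0 * complex_of_real e) \<in> H" unfolding H_def by blast
    from hH[OF this] show ?thesis by simp
  qed
  have hw: "h w = e"
  proof -
    have "(\<lambda>n. 1 * w n + A 0 n, 1 * complex_of_real e) \<in> H" unfolding H_def by blast
    from hH[OF this] show ?thesis by (simp add: A_def cblinfun_zero)
  qed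
  \<comment> \<open>Two errors of size \<open>norm \<psi> * (e / D)\<close> will be added: the
    factor 2 covers both, and the summand 1 makes the total strictly less than \<open>e\<close> and
    keeps \<open>D\<close> positive.\<close>
  define D where "D = (1 + norm \<psi>) * 2"
  have D: "0 < D" by (simp add: D_def add_pos_nonneg)
  obtain M where M: "\<And>\<alpha> m. \<alpha> \<in> ?B \<Longrightarrow> (\<Sum>n\<in>{M..<m}. cmod (\<alpha> n) * norm (a n)) \<le> e / D"
    using lp_ball_tail[OF p norm_ge_zero s, of "e / D"] e D by auto
  define P where "P v = (\<lambda>n. if n < M then v n else 0)" for v :: "nat \<Rightarrow> complex"
  have PV: "P v \<in> V" if v: "v \<in> V" for v
  proof -
    obtain C where C: "C \<ge> 0" "\<And>n. cmod (v n) \<le> C * norm (a n)" using VC[OF v] by blast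
    then show ?thesis by (intro VI[of _ C]) (simp add: P_def)
  qed
  \<comment> \<open>Cutting at \<open>M\<close> costs little, in proportion to the constant
    \<open>C\<close>. This is used with \<open>C = norm x\<close> for \<open>A x\<close> and with
    \<open>C = norm \<psi>\<close> for \<open>w\<close>.\<close>
  have tail: "cmod (h v - h (P v)) \<le> C * (e / D)"
    if C: "0 \<le> C" "\<And>n. cmod (v n) \<le> C * norm (a n)" for v C
  proof -
    have v: "v \<in> V" by (rule VI[OF C(2)])
    define u where "u = (\<lambda>n. if n < M then 0 else v n)"
    have uV: "u \<in> V" using C by (intro VI[of _ C]) (simp add: u_def)
    have "v = (\<lambda>n. P v n + u n)" by (auto simp: P_def u_def)
    then have "h v = h (P v) + h u" using ha[OF PV[OF v] uV] by simp
    then have "cmod (h v - h (P v)) \<le> N u" using hn[OF uV] by simp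
    also have "N u \<le> C * (e / D)"
    proof (rule least)
      fix \<alpha> m assume \<alpha>: "\<alpha> \<in> ?B"
      have "(\<Sum>n<m. cmod (\<alpha> n) * cmod (u n)) = (\<Sum>n\<in>{M..<m}. cmod (\<alpha> n) * cmod (v n))"
        by (rule sum.mono_neutral_cong_right) (auto simp: u_def)
      also have "\<dots> \<le> C * (\<Sum>n\<in>{M..<m}. cmod (\<alpha> n) * norm (a n))"
        by (rule le_C[OF C(2)])
      also have "\<dots> \<le> C * (e / D)"
        by (rule mult_left_mono[OF M[OF \<alpha>] C(1)])
      finally show "(\<Sum>n<m. cmod (\<alpha> n) * cmod (u n)) \<le> C * (e / D)" .
    qed
    finally show ?thesis .
  qed
  text \<open>The unit vector \<open>e\<^sub>n\<close> lies in \<open>V\<close> only if \<open>a n \<noteq> 0\<close>; otherwise all of \<open>V\<close> vanishes at \<open>n\<close>.\<close>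
  define \<gamma> where "\<gamma> n = (if a n = 0 then 0 else h (\<lambda>k. if k = n then 1 else 0))" for n
  \<comment> \<open>On truncated sequences \<open>h\<close> is a finite sum of coordinates weighted
    by \<gamma>, obtained by adding one unit vector at a time.\<close>
  have hP: "h (\<lambda>n. if n < K then v n else 0) = (\<Sum>n<K. \<gamma> n * v n)" if v: "v \<in> V" for v K
  proof (induction K)
    case 0
    show ?case using hA[of 0] by (simp add: A_def cblinfun_zero)
  next
    case (Suc K)
    obtain C where C: "0 \<le> C" "\<And>n. cmod (v n) \<le> C * norm (a n)" using VC[OF v] by blast
    let ?l = "\<lambda>n. if n < K then v n else 0" and ?u = "\<lambda>n. if n = K then 1 else 0 :: complex"
    have l: "?l \<in> V" using C by (intro VI[of _ C]) simp
    show ?case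
    proof (cases "a K = 0")
      case True
      then have "v K = 0" using C(2)[of K] by simp
      then have "(\<lambda>n. if n < Suc K then v n else 0) = ?l" by (auto simp: less_Suc_eq)
      then show ?thesis using Suc True by (simp add: \<gamma>_def)
    next
      case False
      have u: "?u \<in> V" using False by (intro VI[of _ "inverse (norm (a K))"]) auto
      have "(\<lambda>n. if n < Suc K then v n else 0) = (\<lambda>n. ?l n + v K * ?u n)"
        by (auto simp: less_Suc_eq)
      then have "h (\<lambda>n. if n < Suc K then v n else 0) = h ?l + v K * h ?u"
        using ha[OF l sclV[OF u, of "v K"]] hs[OF u, of "v K"] by (simp only:)
      then show ?thesis using Suc False by (simp add: \<gamma>_def)
    qed
  qed
  \<comment> \<open>A partial sum of the series announced above. It may be nonzero, but
    \<open>g x = h (P (A x))\<close> is close to \<open>h (A x) = 0\<close>, uniformly on the unit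
    ball.\<close>
  define g where "g = (\<Sum>n<M. \<gamma> n *\<^sub>C a n)"
  have "norm g \<le> e / D"
  proof (rule norm_cblinfun_bound)
    fix x
    have "g x = h (P (A x))"
      unfolding P_def hP[OF AV]
      by (simp add: g_def A_def cblinfun_apply_sum cblinfun_apply_scaleC scaleC_complex_def)
    moreover have "cmod (h (A x) - h (P (A x))) \<le> norm x * (e / D)"
      by (rule tail) (simp_all add: A_def norm_cblinfun mult.commute[of "norm x"])
    ultimately show "norm (g x) \<le> e / D * norm x"
      by (simp add: hA mult.commute)
  qed (use e D in simp)
  from norm_cblinfun_le[OF order_refl this] have "cmod (\<psi> g) \<le> norm \<psi> * (e / D)" .
  \<comment> \<open>As \<open>g\<close> is a finite sum, linearity of \<psi> carries the estimate
    from the sequences \<open>A x\<close> over to \<open>w\<close>.\<close>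
  moreover have "\<psi> g = h (P w)"
    unfolding P_def hP[OF wV]
    by (simp add: g_def w_def cblinfun_sum cblinfun_scaleC scaleC_complex_def)
  moreover have "cmod (h w - h (P w)) \<le> norm \<psi> * (e / D)"
    by (rule tail) (simp_all add: w_def norm_cblinfun)
  ultimately have "cmod (h w) \<le> 2 * (norm \<psi> * (e / D))"
    using norm_triangle_sub[of "h w" "h (P w)"] by simp
  also have "\<dots> = e * (norm \<psi> / (1 + norm \<psi>))"
    unfolding D_def by (simp del: distrib_left_numeral distrib_right_numeral)
  also have "\<dots> < e * 1"
    using e by (intro mult_strict_left_mono) (simp_all add: divide_less_eq add_pos_nonneg)
  finally show False using e by (simp add: hw)
qed

text \<open>The approximants \<open>x k\<close> of \<psi> make evaluation at \<open>T (x k)\<close>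
  converge to \<psi> composed with \<open>adj T\<close>, uniformly on the unit ball of the dual of
  Y. Hence \<open>T (x k)\<close> is Cauchy in Y, and its limit is the required vector.\<close>

lemma bidual_value_exists:
  fixes T :: "'x::complex_banach \<Rightarrow>\<^sub>C\<^sub>L 'y::complex_banach" and \<psi> :: "'x cdual cdual"
  assumes p: "1 < p" and T: "T \<in> dual_p_compact_ops p"
  shows "\<exists>y. \<forall>\<phi> :: 'y cdual. cblinfun_apply \<phi> y = \<psi> (adj T \<phi>)"
proof -
  obtain a where a: "a \<in> lp_space p"
    and sub: "cblinfun_apply (adj T) ` cball 0 1 \<subseteq> E_op a ` lp_ball (conj_exponent p)"
    using T by (auto simp: dual_p_compact_ops_def p_compact_ops_def p_bounding_def)
  have "\<exists>x. \<forall>\<alpha>\<in>lp_ball (conj_exponent p). \<forall>m.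
      (\<Sum>n<m. cmod (\<alpha> n) * cmod (\<psi> (a n) - a n x)) \<le> inverse (real (Suc k))" for k
    by (rule bidual_approximation[OF p a]) simp
  then obtain x where x: "\<And>k \<alpha> m. \<alpha> \<in> lp_ball (conj_exponent p) \<Longrightarrow>
      (\<Sum>n<m. cmod (\<alpha> n) * cmod (\<psi> (a n) - a n (x k))) \<le> inverse (real (Suc k))"
    by metis
  \<comment> \<open>Expanding \<open>adj T \<phi>\<close> as \<open>E_op a \<alpha>\<close> turns
    the difference into a series whose partial sums the choice of \<open>x k\<close> bounds for
    every \<alpha> at once.\<close>
  have ball: "cmod (\<psi> (adj T \<phi>) - \<phi> (T (x k))) \<le> inverse (real (Suc k))"
    if \<phi>: "norm \<phi> \<le> 1" for \<phi> k
  proof -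
    have "\<phi> \<in> cball 0 1" using \<phi> by simp
    then obtain \<alpha> where \<alpha>: "\<alpha> \<in> lp_ball (conj_exponent p)" and eq: "adj T \<phi> = E_op a \<alpha>"
      using sub by blast
    have sm: "(\<lambda>n. \<alpha> n *\<^sub>C a n) sums adj T \<phi>"
      unfolding eq E_op_def by (rule summable_sums[OF summable_E_op[OF p a \<alpha>]])
    have "(\<lambda>n. \<psi> (\<alpha> n *\<^sub>C a n)) sums \<psi> (adj T \<phi>)"
      by (rule bounded_linear.sums[OF bounded_linear_cblinfun_apply sm])
    moreover have "(\<lambda>n. bidual (x k) (\<alpha> n *\<^sub>C a n)) sums bidual (x k) (adj T \<phi>)"
      by (rule bounded_linear.sums[OF bounded_linear_cblinfun_apply sm])
    ultimately have "(\<lambda>n. \<alpha> n * (\<psi> (a n) - a n (x k))) sums (\<psi> (adj T \<phi>) - \<phi> (T (x k)))"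
      using sums_diff[of "\<lambda>n. \<psi> (\<alpha> n *\<^sub>C a n)" "\<psi> (adj T \<phi>)"
          "\<lambda>n. bidual (x k) (\<alpha> n *\<^sub>C a n)" "bidual (x k) (adj T \<phi>)"]
      by (simp add: bidual.rep_eq cblinfun_scaleC cblinfun_apply_scaleC scaleC_complex_def
          adj_apply right_diff_distrib)
    then have "(\<lambda>m. cmod (\<Sum>n<m. \<alpha> n * (\<psi> (a n) - a n (x k))))
        \<longlonglongrightarrow> cmod (\<psi> (adj T \<phi>) - \<phi> (T (x k)))"
      unfolding sums_def by (rule tendsto_norm)
    then show ?thesis
    proof (rule LIMSEQ_le_const2)
      have "cmod (\<Sum>n<m. \<alpha> n * (\<psi> (a n) - a n (x k))) \<le> inverse (real (Suc k))" for m
        by (rule order_trans[OF norm_sum]) (simp only: norm_mult x[OF \<alpha>])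
      then show "\<exists>K. \<forall>m\<ge>K. cmod (\<Sum>n<m. \<alpha> n * (\<psi> (a n) - a n (x k))) \<le> inverse (real (Suc k))"
        by blast
    qed
  qed
  have "Cauchy (\<lambda>k. T (x k))"
  proof (rule CauchyI)
    fix e :: real assume e: "0 < e"
    then obtain K where K: "inverse (real (Suc K)) < e / 2"
      using reals_Archimedean[of "e / 2"] by auto
    have "norm (T (x k) - T (x l)) < e" if "k \<ge> K" "l \<ge> K" for k l
    proof -
      have "norm (T (x k) - T (x l)) \<le> inverse (real (Suc k)) + inverse (real (Suc l))"
      proof (rule norm_le_dual)
        fix \<phi> :: "'y cdual" assume "norm \<phi> \<le> 1"
        from norm_triangle_ineq4[of "\<psi> (adj T \<phi>) - \<phi> (T (x l))" "\<psi> (adj T \<phi>) - \<phi> (T (x k))"]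
          ball[OF this, of k] ball[OF this, of l]
        show "cmod (\<phi> (T (x k) - T (x l))) \<le> inverse (real (Suc k)) + inverse (real (Suc l))"
          by (simp add: cblinfun_diff)
      qed
      also have "\<dots> \<le> inverse (real (Suc K)) + inverse (real (Suc K))"
        using that by (intro add_mono le_imp_inverse_le) auto
      finally show ?thesis using K by simp
    qed
    then show "\<exists>K. \<forall>k\<ge>K. \<forall>l\<ge>K. norm (T (x k) - T (x l)) < e" by blast
  qed
  then obtain y where y: "(\<lambda>k. T (x k)) \<longlonglongrightarrow> y"
    using Cauchy_convergent_iff convergent_def by blast
  have ball_eq: "cblinfun_apply \<phi> y = \<psi> (adj T \<phi>)" if "norm \<phi> \<le> 1" for \<phi>
  proof -
    have "(\<lambda>k. cblinfun_apply \<phi> (T (x k)) - \<psi> (adj T \<phi>)) \<longlonglongrightarrow> 0"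
    proof (rule Lim_null_comparison[OF always_eventually LIMSEQ_inverse_real_of_nat], rule allI)
      show "cmod (\<phi> (T (x k)) - \<psi> (adj T \<phi>)) \<le> inverse (real (Suc k))" for k
        using ball[OF that, of k] by (simp only: norm_minus_commute)
    qed
    then have "(\<lambda>k. cblinfun_apply \<phi> (T (x k))) \<longlonglongrightarrow> \<psi> (adj T \<phi>)"
      by (rule LIM_zero_cancel)
    moreover have "(\<lambda>k. cblinfun_apply \<phi> (T (x k))) \<longlonglongrightarrow> cblinfun_apply \<phi> y"
      using y by (rule bounded_linear.tendsto[OF bounded_linear_cblinfun_apply])
    ultimately show ?thesis
      using LIMSEQ_unique by blast
  qed
  have "cblinfun_apply \<phi> y = \<psi> (adj T \<phi>)" for \<phi>
  proof (cases "\<phi> = 0")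
    case True
    then show ?thesis by (simp add: cblinfun_zero cblinfun_apply_zero)
  next
    case False
    \<comment> \<open>Rescaling into the unit ball extends the identity to every functional.\<close>
    let ?c = "complex_of_real (inverse (norm \<phi>))"
    have "norm (?c *\<^sub>C \<phi>) \<le> 1"
      unfolding norm_scaleC norm_of_real using False by simp
    from ball_eq[OF this] have "?c * \<phi> y = ?c * \<psi> (adj T \<phi>)"
      by (simp only: cblinfun_scaleC cblinfun_apply_scaleC scaleC_complex_def)
    with False show ?thesis by simp
  qed
  then show ?thesis by blast
qed


section \<open>The extension\<close>

theorem theorem1p9:
  fixes \<iota> :: "'x::complex_banach \<Rightarrow>\<^sub>C\<^sub>L 'z::complex_banach"
    and T :: "'x \<Rightarrow>\<^sub>C\<^sub>L 'y::complex_banach"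
    and lam p :: real
  assumes "\<And>x. norm (\<iota> x) = norm x"
    and "1 \<le> lam"
    and "P_space TYPE('x cdual cdual) lam"
    and "1 < p"
    and "T \<in> dual_p_compact_ops p"
  shows "\<exists>T' :: 'z \<Rightarrow>\<^sub>C\<^sub>L 'y. T' \<in> dual_p_compact_ops p \<and> (\<forall>x. T' (\<iota> x) = T x) \<and>
           kappa_dual p T' \<le> lam * kappa_dual p T"
proof -
  have lam: "0 < lam" using assms(2) by simp
  obtain J :: "'z \<Rightarrow>\<^sub>C\<^sub>L 'x cdual cdual" where J: "\<And>x. J (\<iota> x) = bidual x" "norm J \<le> lam"
    using bidual_extension[OF assms(1,3)] lam by auto
  have "\<forall>z. \<exists>y. \<forall>\<phi> :: 'y cdual. cblinfun_apply \<phi> y = J z (adj T \<phi>)"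
    using bidual_value_exists[OF assms(4,5)] by blast
  \<comment> \<open>\<open>t z\<close> is the vector of Y that represents the second adjoint of
    \<open>T\<close> at \<open>J z\<close>. Since functionals separate points, linearity and the
    norm bound can be checked after applying them.\<close>
  then obtain t where t: "\<And>z (\<phi> :: 'y cdual). cblinfun_apply \<phi> (t z) = J z (adj T \<phi>)" by metis
  obtain T' :: "'z \<Rightarrow>\<^sub>C\<^sub>L 'y" where T': "\<And>z. T' z = t z"
  proof (rule obtain_cblinfun[of t "lam * norm T"])
    show "t (x + y) = t x + t y" for x y
      by (rule dual_separates) (simp add: cblinfun_add t cblinfun_apply_add)
    show "t (c *\<^sub>C x) = c *\<^sub>C t x" for c x
      by (rule dual_separates) (simp add: cblinfun_scaleC t cblinfun_apply_scaleC)
    show "norm (t z) \<le> lam * norm T * norm z" for z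
    proof (rule norm_le_dual)
      fix \<phi> :: "'y cdual" assume "norm \<phi> \<le> 1"
      then have "norm (adj T \<phi>) \<le> norm T"
        using norm_cblinfun_le[OF norm_adj_le[of T]] by fastforce
      moreover have "norm (J z) \<le> lam * norm z"
        by (rule norm_cblinfun_le[OF J(2) order_refl])
      ultimately show "cmod (\<phi> (t z)) \<le> lam * norm T * norm z"
        using norm_cblinfun_le[of "J z" "lam * norm z" "adj T \<phi>" "norm T"] by (simp add: t mult_ac)
    qed
  qed (use lam in auto)
  have ext: "T' (\<iota> x) = T x" for x
    by (rule dual_separates) (simp add: T' t J bidual.rep_eq adj_apply)
  \<comment> \<open>The map from \<phi> to \<open>bidual \<phi> o\<^sub>C\<^sub>L J\<close> is the
    adjoint of \<open>J\<close> restricted to the canonical image of the dual of X.\<close>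
  have R_bound: "norm (bidual \<phi> o\<^sub>C\<^sub>L J) \<le> lam * norm \<phi>" for \<phi> :: "'x cdual"
  proof (rule norm_cblinfun_bound)
    have "norm (J z \<phi>) \<le> (lam * norm z) * norm \<phi>" for z
      by (intro norm_cblinfun_le order_refl J(2))
    then show "norm ((bidual \<phi> o\<^sub>C\<^sub>L J) z) \<le> lam * norm \<phi> * norm z" for z
      by (simp add: cblinfun_compose.rep_eq bidual.rep_eq mult_ac)
  qed (use lam in simp)
  obtain R :: "'x cdual \<Rightarrow>\<^sub>C\<^sub>L 'z cdual"
    where R: "\<And>\<phi>. R \<phi> = bidual \<phi> o\<^sub>C\<^sub>L J" "norm R \<le> lam"
  proof (rule obtain_cblinfun[of "\<lambda>\<phi>. bidual \<phi> o\<^sub>C\<^sub>L J" lam])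
  qed (use R_bound lam in \<open>auto intro!: cblinfun_eqI simp: cblinfun_compose.rep_eq bidual_add
      bidual_scaleC cblinfun_apply_add cblinfun_apply_scaleC\<close>)
  have adj': "adj T' \<phi> = R (adj T \<phi>)" for \<phi>
    by (rule cblinfun_eqI) (simp add: adj_apply T' t R cblinfun_compose.rep_eq bidual.rep_eq)
  have bounding: "(\<lambda>n. R (a n)) \<in> p_bounding p (adj T')" and
    bounding_norm: "lp_norm p (\<lambda>n. R (a n)) \<le> lam * lp_norm p a"
    if a: "a \<in> p_bounding p (adj T)" for a
  proof -
    have lp: "a \<in> lp_space p"
      and sub: "adj T ` cball 0 1 \<subseteq> E_op a ` lp_ball (conj_exponent p)"
      using a by (auto simp: p_bounding_def)
    have "adj T' \<phi> \<in> E_op (\<lambda>n. R (a n)) ` lp_ball (conj_exponent p)" if "\<phi> \<in> cball 0 1" for \<phi>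
    proof -
      obtain \<alpha> where \<alpha>: "\<alpha> \<in> lp_ball (conj_exponent p)" "adj T \<phi> = E_op a \<alpha>"
        using sub \<open>\<phi> \<in> cball 0 1\<close> by blast
      then have "adj T' \<phi> = E_op (\<lambda>n. R (a n)) \<alpha>"
        by (simp add: adj' cblinfun_E_op[OF assms(4) lp])
      with \<alpha>(1) show ?thesis by blast
    qed
    with lp_space_cblinfun(1)[OF _ lp] assms(4)
    show "(\<lambda>n. R (a n)) \<in> p_bounding p (adj T')"
      by (auto simp: p_bounding_def)
    have "lp_norm p (\<lambda>n. R (a n)) \<le> norm R * lp_norm p a"
      using lp_space_cblinfun(2)[OF _ lp] assms(4) by simp
    also have "\<dots> \<le> lam * lp_norm p a"
      by (rule mult_right_mono[OF R(2)]) (simp add: lp_norm_def)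
    finally show "lp_norm p (\<lambda>n. R (a n)) \<le> lam * lp_norm p a" .
  qed
  have ne: "p_bounding p (adj T) \<noteq> {}"
    using assms(5) by (auto simp: dual_p_compact_ops_def p_compact_ops_def)
  then have "T' \<in> dual_p_compact_ops p"
    using bounding by (auto simp: dual_p_compact_ops_def p_compact_ops_def)
  \<comment> \<open>With \<open>lam\<close> moved to the left, the claim is a lower bound for the
    infimum over the witnesses of \<open>T\<close>, and each witness can be treated
    separately.\<close>
  moreover have "kappa_dual p T' / lam \<le> kappa_dual p T"
    unfolding kappa_dual_def kappa_def[of p "adj T"]
  proof (rule cINF_greatest[OF ne])
    fix a assume a: "a \<in> p_bounding p (adj T)"
    have "kappa p (adj T') \<le> lp_norm p (\<lambda>n. R (a n))"
      unfolding kappa_def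
      by (rule cINF_lower[OF bdd_belowI[of _ 0] bounding[OF a]]) (auto simp: lp_norm_def)
    also have "\<dots> \<le> lam * lp_norm p a" by (rule bounding_norm[OF a])
    finally show "kappa p (adj T') / lam \<le> lp_norm p a"
      using lam by (simp add: divide_le_eq mult.commute)
  qed
  ultimately show ?thesis
    using ext lam by (intro exI[of _ T']) (simp add: divide_le_eq mult.commute)
qed

end
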